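(* Let $S$ be a finite pseudo-nilpotent semigroup with principal series $S=S_1\supset S_2\supset\cdots\supset S_m\supset S_{m+1}=\emptyset$. Then: (1) The union $K$ of all isolated subsets $S_i\setminus S_{i+1}$ is the largest nilpotent ideal of $S$, and it is the set of all isolated vertices of $\mathcal{N}_S$ (possibly $K=\emptyset$). (2) If $S_{i_1}\setminus S_{i_1+1}\subseteq S^{(i_2)}$ and $S_{i_2}\setminus S_{i_2+1}\subseteq S^{(i_3)}$, then $S_{i_1}\setminus S_{i_1+1}\subseteq S^{(i_3)}$. If moreover $S_{i_2}\setminus S_{i_2+1}=\mathcal{M}(G_2,I_2,\Lambda_2;P_2)$ and $S_{i_3}\setminus S_{i_3+1}=\mathcal{M}(G_3,I_3,\Lambda_3;P_3)$ are not nilpotent and $\Phi_{i_2}$, $\Phi_{i_3}$ are the pseudo-nilpotent homomorphisms, then $\Phi_{i_3}(a)=\Phi_{i_3}((g;\Phi_{i_2}(a)))$ for every $a\in S_{i_1}\setminus S_{i_1+1}$ and every $g\in G_2$ (here $(g;\Phi_{i_2}(a))$ denotes $(g;e,f)\in S_{i_2}\setminus S_{i_2+1}$ where $(e,f)=\Phi_{i_2}(a)$). (3) If $S_i\setminus S_{i+1}$ is neither an isolated subset nor a root, then there exists a root $S_j\setminus S_{j+1}$ with $i<j$ and $S_i\setminus S_{i+1}\subseteq S^{(j)}$. (4) $S\setminus K=\bigcup S^{(i)}$, where the union runs over all $i$ such that $S_i\setminus S_{i+1}$ is a root. (5) Every stem $S^{(i)}$ is a subsemigroup of $S$. (6) $(S_i\setminus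 S_{i+1})(S_j\setminus S_{j+1})\subseteq K$ if and only if there is no stem containing both $S_i\setminus S_{i+1}$ and $S_j\setminus S_{j+1}$.
   Context: For a semigroup $S$, $S^1$ denotes $S$ with an identity adjoined (if $S$ has none). For $x,y\in S$, $z_1,z_2,\ldots\in S^1$ define $\lambda_0=x$, $\rho_0=y$, $\lambda_{n+1}=\lambda_n z_{n+1}\rho_n$, $\rho_{n+1}=\rho_n z_{n+1}\lambda_n$; write $\lambda_n(x,y,z_1,\ldots,z_n)$, $\rho_n(x,y,z_1,\ldots,z_n)$. $S$ is nilpotent (Mal'cev) if for some $n\ge1$, $\lambda_n(a,b,c_1,\ldots,c_n)=\rho_n(a,b,c_1,\ldots,c_n)$ for all $a,b\in S$, $c_i\in S^1$. $\langle X\rangle$ is the subsemigroup generated by $X$. The upper non-nilpotent graph $\mathcal{N}_S$ has vertex set $S$ and an edge between $x,y$ iff $\langle x,y\rangle$ is not nilpotent. The empty set counts as an ideal; $S/I$ is the Rees factor, $S/\emptyset=S$. $S$ is pseudo-nilpotent if: whenever $x,y\in S$, $w_1,\ldots,w_m\in S^1$, $T$ is the subsemigroup generated by $x,y$ and the $w_i$ lying in $S$, $I$ is a (possibly empty) ideal of $T$, and $t<m$ are non-negative integers with (writing $\lambda_k=\lambda_k(x,y,w_1,\ldots,w_k)$, $\rho_k$ likewise) $\lambda_t\neq\rho_t$, $(\lambda_t,\rho_t)=(\lambda_m,\rho_m)$, $\lambda_m,\rho_m\notin I$, then for all $0\le i\le m$ there is an edge in $\mathcal{N}_{T/I}$ between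 (the images of) $\lambda_i$ and $\rho_i$. A principal series means each $S_i$ is an ideal of $S$ and no ideal lies strictly between $S_{i+1}$ and $S_i$; principal factors are $S_i/S_{i+1}$. For $1\le j\le m$ put $F^{(j)}=\{s\in S\setminus S_j: st\notin S_{j+1}\text{ or }ts\notin S_{j+1}\text{ for some }t\in S_j\setminus S_{j+1}\}$ (the paper's $F_{S_j/S_{j+1}}(S/S_{j+1})$) and $S^{(j)}=F^{(j)}\cup(S_j\setminus S_{j+1})$. $S_i\setminus S_{i+1}$ is a root if $S_i/S_{i+1}$ is not nilpotent and $\langle a,b\rangle$ is nilpotent for all $a\in S_i\setminus S_{i+1}$, $b\in S_{i+1}$; then $S^{(i)}$ is called a stem. $S_i\setminus S_{i+1}$ is an isolated subset if it is not a root and, for every $j$ with $S_i\setminus S_{i+1}\subseteq F^{(j)}$, $S_j/S_{j+1}$ is nilpotent. Rees matrix notation: $\mathcal{M}(G,I,\Lambda;P)$ ($P=(p_{\lambda,i})$ a $\Lambda\times I$ matrix over $G$) consists of triples $(g;i,\lambda)$ with $(g;i,\lambda)(h;j,\mu)=(gp_{\lambda,j}h;i,\mu)$; $G_{i,\ast}=\{(g;i,\lambda):g\in G,\lambda\in\Lambda\}$, $G_{\ast,\lambda}=\{(g;i,\lambda):g\in G,i\in I\}$. If $S_i/S_{i+1}$ is not nilpotent, then $S_i\setminus S_{i+1}$ is a semigroup $\mathcal{M}(G,I,\Lambda;P)$ with all entries of $P$ in $G$, and the pseudo-nilpotent homomorphism $\Phi_i:S\to(I\times\Lambda)^0$ (the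 rectangular band $(i,\lambda)(j,\mu)=(i,\mu)$ with a zero $\theta$ adjoined) is given by $\Phi_i(a)=(e,f)$ for $a\in S^{(i)}$, where $e\in I$, $f\in\Lambda$ are the (unique) indices with $a(S_i\setminus S_{i+1})\subseteq G_{e,\ast}$ and $(S_i\setminus S_{i+1})a\subseteq G_{\ast,f}$, and $\Phi_i(a)=\theta$ for $a\notin S^{(i)}$. *)

theory Defs
  imports "HOL-Algebra.Group"
begin

definition sgrp :: "'a set \<Rightarrow> ('a \<Rightarrow> 'a \<Rightarrow> 'a) \<Rightarrow> bool" where
  "sgrp S f \<longleftrightarrow> (\<forall>x\<in>S. \<forall>y\<in>S. f x y \<in> S) \<and>
     (\<forall>x\<in>S. \<forall>y\<in>S. \<forall>z\<in>S. f (f x y) z = f x (f y z))"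

text \<open>Elements of S^1 are represented as options: None is the adjoined identity.\<close>
definition opt_in :: "'a set \<Rightarrow> 'a option \<Rightarrow> bool" where
  "opt_in S z = (case z of None \<Rightarrow> True | Some c \<Rightarrow> c \<in> S)"

definition mul3 :: "('a \<Rightarrow> 'a \<Rightarrow> 'a) \<Rightarrow> 'a \<Rightarrow> 'a option \<Rightarrow> 'a \<Rightarrow> 'a" where
  "mul3 f l z r = (case z of None \<Rightarrow> f l r | Some c \<Rightarrow> f (f l c) r)"

fun lr :: "('a \<Rightarrow> 'a \<Rightarrow> 'a) \<Rightarrow> 'a \<Rightarrow> 'a \<Rightarrow> (nat \<Rightarrow> 'a option) \<Rightarrow> nat \<Rightarrow> 'a \<times> 'a" where
  "lr f x y z 0 = (x, y)"
| "lr f x y z (Suc n) =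
     (let (l, r) = lr f x y z n in (mul3 f l (z (Suc n)) r, mul3 f r (z (Suc n)) l))"

definition lam :: "('a \<Rightarrow> 'a \<Rightarrow> 'a) \<Rightarrow> 'a \<Rightarrow> 'a \<Rightarrow> (nat \<Rightarrow> 'a option) \<Rightarrow> nat \<Rightarrow> 'a" where
  "lam f x y z n = fst (lr f x y z n)"

definition rho :: "('a \<Rightarrow> 'a \<Rightarrow> 'a) \<Rightarrow> 'a \<Rightarrow> 'a \<Rightarrow> (nat \<Rightarrow> 'a option) \<Rightarrow> nat \<Rightarrow> 'a" where
  "rho f x y z n = snd (lr f x y z n)"

definition nilpotent :: "'a set \<Rightarrow> ('a \<Rightarrow> 'a \<Rightarrow> 'a) \<Rightarrow> bool" where
  "nilpotent S f \<longleftrightarrow> (\<exists>n\<ge>1. \<forall>a\<in>S. \<forall>b\<in>S. \<forall>c. (\<forall>i. opt_in S (c i)) \<longrightarrow>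
       lam f a b c n = rho f a b c n)"

inductive_set gen :: "('a \<Rightarrow> 'a \<Rightarrow> 'a) \<Rightarrow> 'a set \<Rightarrow> 'a set" for f X where
  base: "x \<in> X \<Longrightarrow> x \<in> gen f X"
| mult: "a \<in> gen f X \<Longrightarrow> b \<in> gen f X \<Longrightarrow> f a b \<in> gen f X"

definition nn_edge :: "('a \<Rightarrow> 'a \<Rightarrow> 'a) \<Rightarrow> 'a \<Rightarrow> 'a \<Rightarrow> bool" where
  "nn_edge f x y \<longleftrightarrow> \<not> nilpotent (gen f {x, y}) f"

definition isolated_vertex :: "'a set \<Rightarrow> ('a \<Rightarrow> 'a \<Rightarrow> 'a) \<Rightarrow> 'a \<Rightarrow> bool" where
  "isolated_vertex S f x \<longleftrightarrow> x \<in> S \<and> (\<forall>y\<in>S. y \<noteq> x \<longrightarrow> \<not> nn_edge f x y)"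

text \<open>Ideals (the empty set counts as an ideal).\<close>
definition ideal :: "'a set \<Rightarrow> ('a \<Rightarrow> 'a \<Rightarrow> 'a) \<Rightarrow> 'a set \<Rightarrow> bool" where
  "ideal S f I \<longleftrightarrow> I \<subseteq> S \<and> (\<forall>a\<in>I. \<forall>s\<in>S. f s a \<in> I \<and> f a s \<in> I)"

text \<open>Rees factor T/I: elements of T - I as Some, the zero (present iff I nonempty) as None.\<close>
definition rees_carrier :: "'a set \<Rightarrow> 'a set \<Rightarrow> 'a option set" where
  "rees_carrier T I = Some ` (T - I) \<union> (if I = {} then {} else {None})"

definition rees_mult :: "('a \<Rightarrow> 'a \<Rightarrow> 'a) \<Rightarrow> 'a set \<Rightarrow> 'a option \<Rightarrow> 'a option \<Rightarrow> 'a option" where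
  "rees_mult f I x y = (case (x, y) of (Some a, Some b) \<Rightarrow> (if f a b \<in> I then None else Some (f a b))
                                    | _ \<Rightarrow> None)"

definition rees_img :: "'a set \<Rightarrow> 'a \<Rightarrow> 'a option" where
  "rees_img I a = (if a \<in> I then None else Some a)"

definition pseudo_nilpotent :: "'a set \<Rightarrow> ('a \<Rightarrow> 'a \<Rightarrow> 'a) \<Rightarrow> bool" where
  "pseudo_nilpotent S f \<longleftrightarrow>
    (\<forall>x\<in>S. \<forall>y\<in>S. \<forall>w m t I.
       let T = gen f ({x, y} \<union> {c. \<exists>i\<in>{1..m}. w i = Some c});
           l = lam f x y w; r = rho f x y w in
       (\<forall>i\<in>{1..m}. opt_in S (w i)) \<longrightarrow> ideal T f I \<longrightarrow> t < m \<longrightarrow>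
       l t \<noteq> r t \<longrightarrow> (l t, r t) = (l m, r m) \<longrightarrow> l m \<notin> I \<longrightarrow> r m \<notin> I \<longrightarrow>
       (\<forall>i\<le>m. nn_edge (rees_mult f I) (rees_img I (l i)) (rees_img I (r i))))"

definition principal_series :: "'a set \<Rightarrow> ('a \<Rightarrow> 'a \<Rightarrow> 'a) \<Rightarrow> (nat \<Rightarrow> 'a set) \<Rightarrow> nat \<Rightarrow> bool" where
  "principal_series S f Ss m \<longleftrightarrow>
     Ss 1 = S \<and> Ss (Suc m) = {} \<and>
     (\<forall>i\<in>{1..Suc m}. ideal S f (Ss i)) \<and>
     (\<forall>i\<in>{1..m}. Ss (Suc i) \<subset> Ss i) \<and>
     (\<forall>i\<in>{1..m}. \<forall>J. ideal S f J \<and> Ss (Suc i) \<subseteq> J \<and> J \<subseteq> Ss i \<longrightarrow>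
         J = Ss (Suc i) \<or> J = Ss i)"

definition blk :: "(nat \<Rightarrow> 'a set) \<Rightarrow> nat \<Rightarrow> 'a set" where
  "blk Ss i = Ss i - Ss (Suc i)"

definition factor_nilp :: "('a \<Rightarrow> 'a \<Rightarrow> 'a) \<Rightarrow> (nat \<Rightarrow> 'a set) \<Rightarrow> nat \<Rightarrow> bool" where
  "factor_nilp f Ss i \<longleftrightarrow> nilpotent (rees_carrier (Ss i) (Ss (Suc i))) (rees_mult f (Ss (Suc i)))"

definition FF :: "'a set \<Rightarrow> ('a \<Rightarrow> 'a \<Rightarrow> 'a) \<Rightarrow> (nat \<Rightarrow> 'a set) \<Rightarrow> nat \<Rightarrow> 'a set" where
  "FF S f Ss j = {s \<in> S - Ss j. \<exists>t\<in>blk Ss j. f s t \<notin> Ss (Suc j) \<or> f t s \<notin> Ss (Suc j)}"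

definition Sstar :: "'a set \<Rightarrow> ('a \<Rightarrow> 'a \<Rightarrow> 'a) \<Rightarrow> (nat \<Rightarrow> 'a set) \<Rightarrow> nat \<Rightarrow> 'a set" where
  "Sstar S f Ss j = FF S f Ss j \<union> blk Ss j"

definition is_root :: "('a \<Rightarrow> 'a \<Rightarrow> 'a) \<Rightarrow> (nat \<Rightarrow> 'a set) \<Rightarrow> nat \<Rightarrow> bool" where
  "is_root f Ss i \<longleftrightarrow> \<not> factor_nilp f Ss i \<and>
     (\<forall>a\<in>blk Ss i. \<forall>b\<in>Ss (Suc i). nilpotent (gen f {a, b}) f)"

definition is_isolated :: "'a set \<Rightarrow> ('a \<Rightarrow> 'a \<Rightarrow> 'a) \<Rightarrow> (nat \<Rightarrow> 'a set) \<Rightarrow> nat \<Rightarrow> nat \<Rightarrow> bool" where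
  "is_isolated S f Ss m i \<longleftrightarrow> \<not> is_root f Ss i \<and>
     (\<forall>j\<in>{1..m}. blk Ss i \<subseteq> FF S f Ss j \<longrightarrow> factor_nilp f Ss j)"

definition Kset :: "'a set \<Rightarrow> ('a \<Rightarrow> 'a \<Rightarrow> 'a) \<Rightarrow> (nat \<Rightarrow> 'a set) \<Rightarrow> nat \<Rightarrow> 'a set" where
  "Kset S f Ss m = \<Union> {blk Ss i | i. i \<in> {1..m} \<and> is_isolated S f Ss m i}"

text \<open>Elements (g; i, lambda) are triples; P is indexed as P lambda i.\<close>
definition rm_carrier :: "'g monoid \<Rightarrow> 'i set \<Rightarrow> 'l set \<Rightarrow> ('g \<times> 'i \<times> 'l) set" where
  "rm_carrier G I L = carrier G \<times> I \<times> L"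

definition rm_mult :: "'g monoid \<Rightarrow> ('l \<Rightarrow> 'i \<Rightarrow> 'g) \<Rightarrow> 'g \<times> 'i \<times> 'l \<Rightarrow> 'g \<times> 'i \<times> 'l \<Rightarrow> 'g \<times> 'i \<times> 'l" where
  "rm_mult G P x y = (case x of (g, i, l) \<Rightarrow> case y of (h, j, mu) \<Rightarrow>
                        (g \<otimes>\<^bsub>G\<^esub> P l j \<otimes>\<^bsub>G\<^esub> h, i, mu))"

definition rm_iso :: "('a \<Rightarrow> 'a \<Rightarrow> 'a) \<Rightarrow> (nat \<Rightarrow> 'a set) \<Rightarrow> nat \<Rightarrow> 'g monoid \<Rightarrow> 'i set \<Rightarrow> 'l set
     \<Rightarrow> ('l \<Rightarrow> 'i \<Rightarrow> 'g) \<Rightarrow> ('g \<times> 'i \<times> 'l \<Rightarrow> 'a) \<Rightarrow> bool" where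
  "rm_iso f Ss i G I L P psi \<longleftrightarrow> group G \<and> (\<forall>l\<in>L. \<forall>j\<in>I. P l j \<in> carrier G) \<and>
     bij_betw psi (rm_carrier G I L) (blk Ss i) \<and>
     (\<forall>x\<in>rm_carrier G I L. \<forall>y\<in>rm_carrier G I L. psi (rm_mult G P x y) = f (psi x) (psi y))"

text \<open>Phi_i : S -> (I x Lambda)^0, with None playing the role of the zero theta.\<close>
definition Phi :: "'a set \<Rightarrow> ('a \<Rightarrow> 'a \<Rightarrow> 'a) \<Rightarrow> (nat \<Rightarrow> 'a set) \<Rightarrow> nat \<Rightarrow> 'g monoid \<Rightarrow> 'i set \<Rightarrow> 'l set
     \<Rightarrow> ('g \<times> 'i \<times> 'l \<Rightarrow> 'a) \<Rightarrow> 'a \<Rightarrow> ('i \<times> 'l) option" where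
  "Phi S f Ss i G I L psi a =
     (if a \<in> Sstar S f Ss i then
        Some (THE el. fst el \<in> I \<and> snd el \<in> L \<and>
               f a ` blk Ss i \<subseteq> psi ` (carrier G \<times> {fst el} \<times> L) \<and>
               (\<lambda>x. f x a) ` blk Ss i \<subseteq> psi ` (carrier G \<times> I \<times> {snd el}))
      else None)"

end

theory Submission
  imports Defs
begin

text \<open>
  A finite semigroup fails to be nilpotent iff it has a nonempty set of unequal pairs \<open>(p, q)\<close>, each
  sent by a step \<open>(p, q) \<mapsto> (pwq, qwp)\<close> back into the set. Pseudo-nilpotency says that a pair in such
  a set, taken modulo an ideal, already generates another such set. Applied to pairs that generate
  very little (a null semigroup, or an idempotent together with an element it fixes), this forces the
  complement \<open>J\<close> of \<open>S\<^sub>i\<^sub>+\<^sub>1\<close> in \<open>S\<^sub>i\<close> to be closed under multiplication and to have at least two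
  \<open>\<R>\<close>- or two \<open>\<L>\<close>-classes, whenever the factor is not nilpotent. Then \<open>sJ\<close> meets \<open>J\<close> iff \<open>sJ \<subseteq> J\<close>
  iff \<open>Js \<subseteq> J\<close>, so that the complement of \<open>S\<^sup>(\<^sup>i\<^sup>)\<close> is a prime ideal. Two elements are adjacent in the
  graph only if some \<open>S\<^sup>(\<^sup>i\<^sup>)\<close> with non-nilpotent factor contains both, and every element of such an
  \<open>S\<^sup>(\<^sup>i\<^sup>)\<close> has a neighbour in \<open>J\<close>. Hence \<open>K\<close> is the intersection of these prime ideals, and the roots are
  the non-nilpotent factors that are maximal for \<open>J \<subseteq> S\<^sup>(\<^sup>j\<^sup>)\<close>.
\<close>

section \<open>Recurrent pairs and nilpotency\<close>

text \<open>Small subsemigroups are useless to a recurrent pair because of commutativity: if p, w, q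
  commute, then pwq = qwp, and a single step destroys the inequality. Most contradictions therefore
  build a recurrent set in S and select a pair in it whose generated subsemigroup becomes
  commutative once all factors that force a product into the ideal are discarded. The difficulty is
  that only the pair is under control in the subsemigroup it generates, whereas the set has to be
  recurrent in S; the middle factor w is free, so it is taken from a Green class whose products with
  both members of the pair stay in J. Which products stay in J depends only on one-sided classes,
  and this is why the argument runs through these classes. The notions are formulated so that they
  survive reversing the multiplication, so most left-hand facts come from right-hand ones. Two
  classes in J are what gives an arbitrary stem element a partner: one of them differs from the
  class into which it moves w. Matrix coordinates enter only at the end, for
  \<open>Phi\<close>.\<close>

text \<open>The parameter \<open>Z\<close> allows work modulo an ideal inside S itself, without the
  option type of the Rees factor. Symmetry is required because reversing the multiplication turns a
  step to (pwq, qwp) into a step to (qwp, pwq).\<close>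

definition recurrent :: "('a \<Rightarrow> 'a \<Rightarrow> 'a) \<Rightarrow> 'a set \<Rightarrow> 'a set \<Rightarrow> ('a \<times> 'a) set \<Rightarrow> bool" where
  "recurrent f T Z B \<longleftrightarrow> sym B \<and> (\<forall>p q. (p, q) \<in> B \<longrightarrow> p \<in> T - Z \<and> q \<in> T - Z \<and> p \<noteq> q \<and>
     (\<exists>w. opt_in T w \<and> (mul3 f p w q, mul3 f q w p) \<in> B))"

lemma recurrentD:
  assumes "recurrent f T Z B" "(p, q) \<in> B"
  shows "p \<in> T" "q \<in> T" "p \<notin> Z" "q \<notin> Z" "p \<noteq> q" "(q, p) \<in> B"
    "\<exists>w. opt_in T w \<and> (mul3 f p w q, mul3 f q w p) \<in> B"
  using assms unfolding recurrent_def by (auto dest: symD)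

lemma opt_in_mono: "opt_in T w \<Longrightarrow> T \<subseteq> T' \<Longrightarrow> opt_in T' w"
  by (auto simp: opt_in_def split: option.splits)

lemma recurrent_mono: "recurrent f T Z B \<Longrightarrow> T \<subseteq> T' \<Longrightarrow> recurrent f T' Z B"
  unfolding recurrent_def using opt_in_mono[of T _ T'] by blast

lemma lam_rho_simps [simp]:
  "lam f x y w 0 = x" "rho f x y w 0 = y"
  "lam f x y w (Suc n) = mul3 f (lam f x y w n) (w (Suc n)) (rho f x y w n)"
  "rho f x y w (Suc n) = mul3 f (rho f x y w n) (w (Suc n)) (lam f x y w n)"
  by (simp_all add: lam_def rho_def Let_def split: prod.splits)

text \<open>Choosing a step at every pair turns the existential condition into one sequence of
  parameters, the form in which nilpotency and pseudo-nilpotency quantify.\<close>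

lemma recurrent_sequence:
  assumes B: "recurrent f T Z B" and xy: "(x, y) \<in> B"
  obtains w where "\<And>i. opt_in T (w i)" "\<And>n. (lam f x y w n, rho f x y w n) \<in> B"
proof -
  define g where "g pq = (SOME w. opt_in T w \<and>
      (mul3 f (fst pq) w (snd pq), mul3 f (snd pq) w (fst pq)) \<in> B)" for pq
  have g: "opt_in T (g (p, q)) \<and> (mul3 f p (g (p, q)) q, mul3 f q (g (p, q)) p) \<in> B"
    if "(p, q) \<in> B" for p q
    unfolding g_def using someI_ex[OF recurrentD(7)[OF B that]] by simp
  define P where "P = rec_nat (x, y)
    (\<lambda>_ pq. (mul3 f (fst pq) (g pq) (snd pq), mul3 f (snd pq) (g pq) (fst pq)))"
  have P0: "P 0 = (x, y)" by (simp add: P_def)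
  have PS: "P (Suc n) = (mul3 f (fst (P n)) (g (P n)) (snd (P n)),
    mul3 f (snd (P n)) (g (P n)) (fst (P n)))" for n
    by (simp add: P_def)
  have PB: "P n \<in> B" for n
  proof (induction n)
    case 0 show ?case using xy by (simp add: P0)
  next
    case (Suc n) then show ?case using g[of "fst (P n)" "snd (P n)"] by (simp add: PS)
  qed
  \<comment> \<open>\<open>lam\<close> and \<open>rho\<close> read \<open>w (Suc n)\<close> when
    passing from n to \<open>Suc n\<close>, so the step chosen at \<open>P n\<close> is stored one
    place later; index 0 receives the identity.\<close>
  define w where "w i = (case i of 0 \<Rightarrow> None | Suc n \<Rightarrow> g (P n))" for i
  have eq: "(lam f x y w n, rho f x y w n) = P n" for n
  proof (induction n)
    case (Suc n)
    have "lam f x y w n = fst (P n)" "rho f x y w n = snd (P n)"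
      using Suc by (metis fst_conv, metis snd_conv)
    moreover have "w (Suc n) = g (P n)" by (simp add: w_def)
    ultimately show ?case by (simp add: PS)
  qed (simp add: P0)
  have "opt_in T (w i)" for i
    using g[of "fst (P (i - 1))" "snd (P (i - 1))"] PB[of "i - 1"]
    by (cases i) (auto simp: w_def opt_in_def)
  moreover have "(lam f x y w n, rho f x y w n) \<in> B" for n unfolding eq by (rule PB)
  ultimately show thesis by (rule that)
qed

lemma lam_rho_closed:
  assumes "\<And>x y. x \<in> T \<Longrightarrow> y \<in> T \<Longrightarrow> f x y \<in> T" "\<And>i. opt_in T (w i)" "x \<in> T" "y \<in> T"
  shows "lam f x y w n \<in> T \<and> rho f x y w n \<in> T"
proof (induction n)
  case (Suc n)
  then show ?case using assms(1) assms(2)[of "Suc n"]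
    by (auto simp: mul3_def opt_in_def split: option.splits)
qed (use assms in auto)

lemma pairs_repeat:
  assumes "finite C" "\<And>k. k \<le> card C \<Longrightarrow> h k \<in> C"
  obtains s t where "s < t" "t \<le> card C" "h s = h t"
proof -
  have "card (h ` {..card C}) \<le> card C"
    using assms by (intro card_mono) auto
  then have "\<not> inj_on h {..card C}"
    using card_image[of h "{..card C}"] by auto
  then obtain s t where "s \<le> card C" "t \<le> card C" "s \<noteq> t" "h s = h t"
    by (auto simp: inj_on_def)
  then show thesis using that[of s t] that[of t s] by (cases "s < t") auto
qed

text \<open>A sequence inside a recurrent set never has equal entries. Conversely, without
  nilpotency some sequence keeps unequal entries for longer than there are pairs; it repeats a pair,
  and the loop so obtained, made symmetric, is recurrent.\<close>

lemma nilpotent_iff_no_recurrent: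
  assumes fin: "finite T" and closed: "\<And>x y. x \<in> T \<Longrightarrow> y \<in> T \<Longrightarrow> f x y \<in> T"
  shows "nilpotent T f \<longleftrightarrow> \<not> (\<exists>B. B \<noteq> {} \<and> recurrent f T {} B)"
proof
  assume nil: "nilpotent T f"
  show "\<not> (\<exists>B. B \<noteq> {} \<and> recurrent f T {} B)"
  proof
    assume "\<exists>B. B \<noteq> {} \<and> recurrent f T {} B"
    then obtain B x y where B: "recurrent f T {} B" and xy: "(x, y) \<in> B" by auto
    obtain w where w: "\<And>i. opt_in T (w i)" "\<And>n. (lam f x y w n, rho f x y w n) \<in> B"
      using recurrent_sequence[OF B xy] by metis
    have "x \<in> T" "y \<in> T" using recurrentD[OF B xy] by auto
    then obtain n where "lam f x y w n = rho f x y w n"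
      using nil w(1) unfolding nilpotent_def by metis
    then show False using recurrentD(5)[OF B w(2)] by blast
  qed
next
  assume none: "\<not> (\<exists>B. B \<noteq> {} \<and> recurrent f T {} B)"
  show "nilpotent T f"
  proof (rule ccontr)
    assume nn: "\<not> nilpotent T f"
    \<comment> \<open>\<open>Suc\<close> provides the bound \<open>n >= 1\<close> of
      \<open>nilpotent\<close>; every index at which the repetition can occur is below N.\<close>
    define N where "N = Suc (card (T \<times> T))"
    obtain a b w where ab: "a \<in> T" "b \<in> T" "\<And>i. opt_in T (w i)"
      and ne: "lam f a b w N \<noteq> rho f a b w N"
      using nn unfolding nilpotent_def N_def by (metis le_add1 plus_1_eq_Suc)
    let ?l = "lam f a b w" and ?r = "rho f a b w"
    have inT: "?l n \<in> T" "?r n \<in> T" for n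
      using lam_rho_closed[of T f w a b n] closed ab by auto
    have eqmono: "?l k = ?r k \<Longrightarrow> ?l (k + d) = ?r (k + d)" for k d
      by (induction d) auto
    \<comment> \<open>Equal entries stay equal, so the inequality at N holds at all earlier
      indices.\<close>
    have nek: "?l k \<noteq> ?r k" if "k \<le> N" for k
      using eqmono[of k "N - k"] ne that by auto
    obtain s t where st: "s < t" "t \<le> card (T \<times> T)" "(?l s, ?r s) = (?l t, ?r t)"
      using pairs_repeat[of "T \<times> T" "\<lambda>k. (?l k, ?r k)"] fin inT by (metis (no_types, lifting) finite_SigmaI mem_Sigma_iff)
    define B0 where "B0 = (\<lambda>k. (?l k, ?r k)) ` {s..<t}"
    define B where "B = B0 \<union> B0\<inverse>"
    have step: "(mul3 f (?l k) (w (Suc k)) (?r k), mul3 f (?r k) (w (Suc k)) (?l k)) \<in> B0"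
      if "k \<in> {s..<t}" for k
    proof (cases "Suc k = t")
      \<comment> \<open>The last pair of the loop steps back to the first.\<close>
      case True
      then have "(mul3 f (?l k) (w (Suc k)) (?r k), mul3 f (?r k) (w (Suc k)) (?l k)) = (?l s, ?r s)"
        using st(3) by auto
      then show ?thesis using st(1) unfolding B0_def by auto
    next
      case False
      then have "Suc k \<in> {s..<t}" using that by auto
      then show ?thesis unfolding B0_def
        by (metis (mono_tags, lifting) imageI lam_rho_simps(3,4))
    qed
    have B0: "p \<in> T \<and> q \<in> T \<and> p \<noteq> q \<and> (\<exists>w. opt_in T w \<and> (mul3 f p w q, mul3 f q w p) \<in> B0)"
      if pq: "(p, q) \<in> B0" for p q
    proof -
      obtain k where k: "k \<in> {s..<t}" "p = ?l k" "q = ?r k" using pq unfolding B0_def by blast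
      have "p \<noteq> q" using nek[of k] k st by (auto simp: N_def)
      then show ?thesis using step[OF k(1)] inT ab(3) k by blast
    qed
    have "recurrent f T {} B"
      unfolding recurrent_def
    proof (intro conjI allI impI)
      show "sym B" unfolding B_def by (simp add: sym_Un_converse)
      fix p q assume "(p, q) \<in> B"
      then have "(p, q) \<in> B0 \<or> (q, p) \<in> B0" by (auto simp: B_def)
      with B0 show "p \<in> T - {}" "q \<in> T - {}" "p \<noteq> q"
        "\<exists>w. opt_in T w \<and> (mul3 f p w q, mul3 f q w p) \<in> B"
        unfolding B_def by (blast, blast, blast, blast)
    qed
    moreover have "B \<noteq> {}" using st by (auto simp: B_def B0_def)
    ultimately show False using none by blast
  qed
qed

section \<open>Recurrent sets modulo an ideal and Rees factors\<close>

text \<open>Two option layers meet: the outer \<open>None\<close> of \<open>w\<close> is the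
  adjoined identity, the inner one the zero of the Rees factor. A nonzero product has no zero
  factor, so \<open>w\<close> comes from some \<open>w'\<close> without inner zero.\<close>

lemma mul3_rees:
  assumes "mul3 (rees_mult f Z) p w q = Some r"
  obtains p' w' q' where "p = Some p'" "q = Some q'" "w = map_option Some w'" "r = mul3 f p' w' q'" "r \<notin> Z"
proof (cases w)
  case None
  then show thesis using assms that[of _ _ None]
    by (auto simp: mul3_def rees_mult_def split: option.splits if_splits)
next
  case (Some c)
  then show thesis using assms that[of _ _ "Some (the c)"]
    by (auto simp: mul3_def rees_mult_def split: option.splits if_splits)
qed

lemma mul3_rees_None [simp]:
  "mul3 (rees_mult f Z) None w q = None" "mul3 (rees_mult f Z) p w None = None"
  by (auto simp: mul3_def rees_mult_def split: option.splits)

text \<open>A pair containing the zero would step to a pair with both entries zero, against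
  inequality; hence all pairs lift. \<open>U\<close> may or may not contain the zero.\<close>

lemma recurrent_of_rees:
  assumes B: "recurrent (rees_mult f Z) U {} B" "B \<noteq> {}" and U: "U \<subseteq> insert None (Some ` (T - Z))"
  shows "\<exists>B'. B' \<noteq> {} \<and> recurrent f T Z B'"
proof -
  have nn: "p \<noteq> None \<and> q \<noteq> None" if pq: "(p, q) \<in> B" for p q
  proof -
    obtain w where "(mul3 (rees_mult f Z) p w q, mul3 (rees_mult f Z) q w p) \<in> B"
      using recurrentD(7)[OF B(1) pq] by blast
    then have "mul3 (rees_mult f Z) p w q \<noteq> mul3 (rees_mult f Z) q w p"
      by (rule recurrentD(5)[OF B(1)])
    then show ?thesis by (cases p; cases q) auto
  qed
  define B' where "B' = {(p, q). (Some p, Some q) \<in> B}"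
  have "recurrent f T Z B'" unfolding recurrent_def
  proof (intro conjI allI impI)
    show "sym B'" using recurrentD(6)[OF B(1)] by (auto simp: B'_def sym_def)
    fix p q assume "(p, q) \<in> B'"
    then have pq: "(Some p, Some q) \<in> B" by (simp add: B'_def)
    note D = recurrentD[OF B(1) pq]
    show "p \<in> T - Z" "q \<in> T - Z" "p \<noteq> q" using D(1,2,5) U by auto
    obtain w where w: "opt_in U w"
      "(mul3 (rees_mult f Z) (Some p) w (Some q), mul3 (rees_mult f Z) (Some q) w (Some p)) \<in> B"
      using D(7) by blast
    obtain r1 r2 where r: "mul3 (rees_mult f Z) (Some p) w (Some q) = Some r1"
      "mul3 (rees_mult f Z) (Some q) w (Some p) = Some r2"
      using nn[OF w(2)] by auto
    obtain w' where w': "w = map_option Some w'" "r1 = mul3 f p w' q" using r(1) by (elim mul3_rees) auto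
    then have "r2 = mul3 f q w' p" using r(2)
      by (elim mul3_rees) (metis (no_types) option.inject option.inj_map_strong)
    moreover have "opt_in T w'" using w(1) w'(1) U by (auto simp: opt_in_def split: option.splits)
    ultimately show "\<exists>w. opt_in T w \<and> (mul3 f p w q, mul3 f q w p) \<in> B'"
      using w(2) r w' by (auto simp: B'_def)
  qed
  moreover have "B' \<noteq> {}"
  proof -
    obtain p q where "(p, q) \<in> B" using B(2) by auto
    then show ?thesis using nn unfolding B'_def by fastforce
  qed
  ultimately show ?thesis by blast
qed

lemma recurrent_to_rees:
  assumes B: "recurrent f T Z B" and id: "ideal T f Z"
  shows "recurrent (rees_mult f Z) (rees_carrier T Z) {} (map_prod Some Some ` B)"
  unfolding recurrent_def
proof (intro conjI allI impI)
  show "sym (map_prod Some Some ` B)"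
    using recurrentD(6)[OF B] by (fastforce simp: sym_def)
  fix p' q' assume "(p', q') \<in> map_prod Some Some ` B"
  then obtain p q where pq: "p' = Some p" "q' = Some q" "(p, q) \<in> B" by auto
  note D = recurrentD[OF B pq(3)]
  show "p' \<in> rees_carrier T Z - {}" "q' \<in> rees_carrier T Z - {}" "p' \<noteq> q'"
    using D pq by (auto simp: rees_carrier_def)
  obtain w where w: "opt_in T w" "(mul3 f p w q, mul3 f q w p) \<in> B" using D(7) by blast
  note D' = recurrentD(3,4)[OF B w(2)]
  have eq: "mul3 (rees_mult f Z) (Some p) (map_option Some w) (Some q) = Some (mul3 f p w q)"
    "mul3 (rees_mult f Z) (Some q) (map_option Some w) (Some p) = Some (mul3 f q w p)"
    using D D' id w(1)
    by (auto simp: mul3_def rees_mult_def ideal_def opt_in_def split: option.splits)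
  \<comment> \<open>A middle factor in the ideal would pull the next pair into
    \<open>Z\<close>.\<close>
  have "c \<notin> Z" if "w = Some c" for c
    using that D D' w(1) id by (auto simp: mul3_def ideal_def opt_in_def)
  then have "opt_in (rees_carrier T Z) (map_option Some w)"
    using w(1) by (auto simp: opt_in_def rees_carrier_def split: option.splits)
  then show "\<exists>w. opt_in (rees_carrier T Z) w \<and>
    (mul3 (rees_mult f Z) p' w q', mul3 (rees_mult f Z) q' w p') \<in> map_prod Some Some ` B"
    using eq w(2) pq by (intro exI[of _ "map_option Some w"]) auto
qed

lemma rees_nilpotent_iff:
  assumes fin: "finite T" and closed: "\<And>x y. x \<in> T \<Longrightarrow> y \<in> T \<Longrightarrow> f x y \<in> T" and id: "ideal T f Z"
  shows "nilpotent (rees_carrier T Z) (rees_mult f Z) \<longleftrightarrow> \<not> (\<exists>B. B \<noteq> {} \<and> recurrent f T Z B)"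
proof -
  have "finite (rees_carrier T Z)" using fin by (auto simp: rees_carrier_def)
  moreover have "rees_mult f Z x y \<in> rees_carrier T Z"
    if "x \<in> rees_carrier T Z" "y \<in> rees_carrier T Z" for x y
    using that closed by (auto simp: rees_carrier_def rees_mult_def split: if_splits)
  ultimately have "nilpotent (rees_carrier T Z) (rees_mult f Z) \<longleftrightarrow>
     \<not> (\<exists>B. B \<noteq> {} \<and> recurrent (rees_mult f Z) (rees_carrier T Z) {} B)"
    by (rule nilpotent_iff_no_recurrent)
  also have "\<dots> \<longleftrightarrow> \<not> (\<exists>B. B \<noteq> {} \<and> recurrent f T Z B)"
  proof -
    have "rees_carrier T Z \<subseteq> insert None (Some ` (T - Z))" by (auto simp: rees_carrier_def)
    then show ?thesis using recurrent_of_rees recurrent_to_rees[OF _ id]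
      by (metis (no_types, lifting) image_is_empty)
  qed
  finally show ?thesis .
qed

lemma gen_closed: "x \<in> gen f X \<Longrightarrow> y \<in> gen f X \<Longrightarrow> f x y \<in> gen f X"
  by (rule gen.mult)

lemma gen_subset:
  assumes "X \<subseteq> T" "\<And>x y. x \<in> T \<Longrightarrow> y \<in> T \<Longrightarrow> f x y \<in> T"
  shows "gen f X \<subseteq> T"
proof
  fix x assume "x \<in> gen f X" then show "x \<in> T" by induction (use assms in auto)
qed

lemma gen_mono: "X \<subseteq> Y \<Longrightarrow> gen f X \<subseteq> gen f Y"
  by (rule gen_subset) (auto intro: gen.intros)

lemma gen_dual: "gen (\<lambda>x y. f y x) X = gen f X"
proof
  show "gen (\<lambda>x y. f y x) X \<subseteq> gen f X" by (rule gen_subset) (auto intro: gen.intros)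
  show "gen f X \<subseteq> gen (\<lambda>x y. f y x) X"
    by (rule gen_subset) (auto intro: gen.base gen.mult[where f = "\<lambda>x y. f y x"])
qed

text \<open>The only form in which pseudo-nilpotency is used. Unlike the definition it is
  visibly invariant under reversing the multiplication.\<close>

definition pairs_inherit :: "'a set \<Rightarrow> ('a \<Rightarrow> 'a \<Rightarrow> 'a) \<Rightarrow> bool" where
  "pairs_inherit S f \<longleftrightarrow> (\<forall>Z B x y. ideal S f Z \<longrightarrow> recurrent f S Z B \<longrightarrow> (x, y) \<in> B \<longrightarrow>
     (\<exists>B'. B' \<noteq> {} \<and> recurrent f (gen f {x, y}) Z B'))"

text \<open>A sequence inside the finite set \<open>B\<close> repeats a pair, which supplies the
  indices t < m of the definition. The resulting edge at index 0 joins x and y and says that they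
  generate a non-nilpotent subsemigroup of the Rees factor.\<close>

lemma pseudo_nilpotent_pairs_inherit:
  assumes S: "sgrp S f" and fin: "finite S" and pn: "pseudo_nilpotent S f"
  shows "pairs_inherit S f"
  unfolding pairs_inherit_def
proof (intro allI impI)
  fix Z B x y
  assume Z: "ideal S f Z" and B: "recurrent f S Z B" and xy: "(x, y) \<in> B"
  note D = recurrentD[OF B xy]
  obtain w where w: "\<And>i. opt_in S (w i)" "\<And>n. (lam f x y w n, rho f x y w n) \<in> B"
    using recurrent_sequence[OF B xy] by metis
  have "B \<subseteq> S \<times> S" using recurrentD(1,2)[OF B] by auto
  then have "finite B" using fin finite_subset by blast
  then obtain t m where tm: "t < m" "(lam f x y w t, rho f x y w t) = (lam f x y w m, rho f x y w m)"
    using pairs_repeat[of B "\<lambda>n. (lam f x y w n, rho f x y w n)"] w(2) by metis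
  define T where "T = gen f ({x, y} \<union> {c. \<exists>i\<in>{1..m}. w i = Some c})"
  have "{c. \<exists>i\<in>{1..m}. w i = Some c} \<subseteq> S"
    using w(1) by (fastforce simp: opt_in_def split: option.splits)
  then have TS: "T \<subseteq> S" unfolding T_def using D S by (intro gen_subset) (auto simp: sgrp_def)
  \<comment> \<open>The definition asks for an ideal of \<open>T\<close>. On
    \<open>gen f {x, y}\<close>, which lies in \<open>T\<close>, belonging to it is the same as
    belonging to \<open>Z\<close>.\<close>
  have id: "ideal T f (Z \<inter> T)"
    using Z TS by (auto simp: ideal_def T_def intro: gen_closed)
  note E = recurrentD[OF B w(2)]
  have "\<forall>i\<le>m. nn_edge (rees_mult f (Z \<inter> T)) (rees_img (Z \<inter> T) (lam f x y w i))
      (rees_img (Z \<inter> T) (rho f x y w i))"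
    using pn[unfolded pseudo_nilpotent_def Let_def, rule_format, of x y m w "Z \<inter> T" t] D(1,2) w(1) id tm E
    unfolding T_def by blast
  then have "nn_edge (rees_mult f (Z \<inter> T)) (Some x) (Some y)"
    using D by (force simp: rees_img_def)
  then have nn: "\<not> nilpotent (gen (rees_mult f (Z \<inter> T)) {Some x, Some y}) (rees_mult f (Z \<inter> T))"
    by (simp add: nn_edge_def)
  have gT: "gen f {x, y} \<subseteq> T" unfolding T_def by (rule gen_mono) auto
  have "v \<in> insert None (Some ` (gen f {x, y} - (Z \<inter> T)))"
    if "v \<in> gen (rees_mult f (Z \<inter> T)) {Some x, Some y}" for v
    using that
  proof induction
    case (base v) then show ?case using D by (auto intro: gen.base)
  next
    case (mult a b)
    have key: "rees_mult f (Z \<inter> T) (Some p) (Some q) \<in> insert None (Some ` (gen f {x, y} - (Z \<inter> T)))"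
      if "p \<in> gen f {x, y}" "q \<in> gen f {x, y}" for p q
      using gen_closed[OF that] by (auto simp: rees_mult_def)
    show ?case
    proof (cases "a = None \<or> b = None")
      case True
      then show ?thesis by (auto simp: rees_mult_def split: option.splits)
    next
      case False
      then obtain p q where "a = Some p" "b = Some q" "p \<in> gen f {x, y}" "q \<in> gen f {x, y}"
        using mult.IH by auto
      then show ?thesis using key by simp
    qed
  qed
  then have sub: "gen (rees_mult f (Z \<inter> T)) {Some x, Some y} \<subseteq> insert None (Some ` (gen f {x, y} - (Z \<inter> T)))"
    by blast
  have "finite (gen (rees_mult f (Z \<inter> T)) {Some x, Some y})"
    using sub gT TS fin by (meson finite.insertI finite_Diff finite_imageI finite_subset)
  then have "\<exists>B. B \<noteq> {} \<and> recurrent (rees_mult f (Z \<inter> T)) (gen (rees_mult f (Z \<inter> T)) {Some x, Some y}) {} B"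
    using nn nilpotent_iff_no_recurrent gen_closed by metis
  then obtain B' where B': "B' \<noteq> {}" "recurrent f (gen f {x, y}) (Z \<inter> T) B'"
    using recurrent_of_rees[OF _ _ sub] by blast
  have "recurrent f (gen f {x, y}) Z B'"
    using B'(2) gT unfolding recurrent_def by blast
  then show "\<exists>B'. B' \<noteq> {} \<and> recurrent f (gen f {x, y}) Z B'" using B'(1) by blast
qed

section \<open>Reversal of the multiplication\<close>

lemma mul3_dual:
  assumes "sgrp S f" "p \<in> S" "q \<in> S" "opt_in S w"
  shows "mul3 (\<lambda>x y. f y x) p w q = mul3 f q w p"
  using assms by (auto simp: mul3_def opt_in_def sgrp_def split: option.splits)

lemma recurrent_dual:
  assumes S: "sgrp S f" and T: "T \<subseteq> S" and B: "recurrent f T Z B"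
  shows "recurrent (\<lambda>x y. f y x) T Z B"
  unfolding recurrent_def
proof (intro conjI allI impI)
  show "sym B" using B by (simp add: recurrent_def)
  fix p q assume pq: "(p, q) \<in> B"
  note D = recurrentD[OF B pq]
  show "p \<in> T - Z" "q \<in> T - Z" "p \<noteq> q" using D by auto
  obtain w where w: "opt_in T w" "(mul3 f p w q, mul3 f q w p) \<in> B" using D(7) by blast
  moreover have "opt_in S w" using w(1) T by (rule opt_in_mono)
  ultimately show "\<exists>w. opt_in T w \<and> (mul3 (\<lambda>x y. f y x) p w q, mul3 (\<lambda>x y. f y x) q w p) \<in> B"
    using mul3_dual[OF S] D(1,2) T recurrentD(6)[OF B w(2)] by (metis subsetD)
qed

lemma sgrp_dual: "sgrp S f \<Longrightarrow> sgrp S (\<lambda>x y. f y x)"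
  by (auto simp: sgrp_def)

lemma ideal_dual: "ideal S (\<lambda>x y. f y x) Z \<longleftrightarrow> ideal S f Z"
  by (auto simp: ideal_def)

lemma pairs_inherit_dual:
  assumes S: "sgrp S f" and pn: "pairs_inherit S f"
  shows "pairs_inherit S (\<lambda>x y. f y x)"
  unfolding pairs_inherit_def
proof (intro allI impI)
  fix Z B x y
  assume Z: "ideal S (\<lambda>x y. f y x) Z" and B: "recurrent (\<lambda>x y. f y x) S Z B" and xy: "(x, y) \<in> B"
  have Z': "ideal S f Z" using Z by (simp only: ideal_dual[of S f])
  have B': "recurrent f S Z B"
    using recurrent_dual[of S "\<lambda>x y. f y x" S Z B, OF sgrp_dual[OF S] subset_refl B] .
  obtain B'' where B'': "B'' \<noteq> {}" "recurrent f (gen f {x, y}) Z B''"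
    using pn[unfolded pairs_inherit_def, rule_format, OF Z' B' xy] by blast
  have "gen f {x, y} \<subseteq> S" using S recurrentD(1,2)[OF B xy] by (intro gen_subset) (auto simp: sgrp_def)
  then show "\<exists>B'. B' \<noteq> {} \<and> recurrent (\<lambda>x y. f y x) (gen (\<lambda>x y. f y x) {x, y}) Z B'"
    using recurrent_dual[OF S _ B''(2)] B''(1) unfolding gen_dual[of f "{x, y}"] by blast
qed


section \<open>Green's relations in a principal factor\<close>

text \<open>The principal right ideal of \<open>a\<close> in \<open>S^1\<close>; two elements are
  R-related in Green's sense when these sets agree.\<close>

definition Rs :: "'a set \<Rightarrow> ('a \<Rightarrow> 'a \<Rightarrow> 'a) \<Rightarrow> 'a \<Rightarrow> 'a set" where
  "Rs S f a = insert a (f a ` S)"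

abbreviation Ls :: "'a set \<Rightarrow> ('a \<Rightarrow> 'a \<Rightarrow> 'a) \<Rightarrow> 'a \<Rightarrow> 'a set" where
  "Ls S f \<equiv> Rs S (\<lambda>x y. f y x)"

lemma Rs_self [simp]: "a \<in> Rs S f a"
  by (simp add: Rs_def)

locale pn_semigroup =
  fixes S :: "'a set" and f :: "'a \<Rightarrow> 'a \<Rightarrow> 'a" (infixl "\<cdot>" 70)
  assumes sgrp: "sgrp S f" and finite_S: "finite S" and inherit: "pairs_inherit S f"
begin

lemma closed [simp]: "x \<in> S \<Longrightarrow> y \<in> S \<Longrightarrow> x \<cdot> y \<in> S"
  using sgrp by (simp add: sgrp_def)

lemma assoc: "x \<in> S \<Longrightarrow> y \<in> S \<Longrightarrow> z \<in> S \<Longrightarrow> x \<cdot> y \<cdot> z = x \<cdot> (y \<cdot> z)"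
  using sgrp by (simp add: sgrp_def)

lemma inheritD:
  assumes "ideal S f Z" "recurrent f S Z B" "(x, y) \<in> B"
  obtains B' where "B' \<noteq> {}" "recurrent f (gen f {x, y}) Z B'"
  using inherit[unfolded pairs_inherit_def, rule_format, OF assms] by blast

lemma gen_sub: "X \<subseteq> S \<Longrightarrow> gen f X \<subseteq> S"
  by (rule gen_subset) auto

lemma Rs_sub: "a \<in> S \<Longrightarrow> Rs S f a \<subseteq> S"
  by (auto simp: Rs_def)

lemma Rs_trans:
  assumes "a \<in> S" "b \<in> Rs S f a" shows "Rs S f b \<subseteq> Rs S f a"
  using assms by (auto simp: Rs_def assoc)

section \<open>Generated subsemigroups without recurrent sets\<close>

lemma gen_commute:
  assumes X: "X \<subseteq> S" and comm: "\<And>x y. x \<in> X \<Longrightarrow> y \<in> X \<Longrightarrow> x \<cdot> y = y \<cdot> x"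
    and p: "p \<in> gen f X" and q: "q \<in> gen f X"
  shows "p \<cdot> q = q \<cdot> p"
proof -
  have sub: "gen f X \<subseteq> S" using X by (rule gen_sub)
  have 1: "p \<cdot> x = x \<cdot> p" if p: "p \<in> gen f X" and x: "x \<in> X" for p x
    using p
  proof induction
    case (base y) then show ?case using comm x by simp
  next
    case (mult b c)
    have "b \<in> S" "c \<in> S" "x \<in> S" using mult sub x X by auto
    then show ?case using mult.IH assoc by metis
  qed
  show ?thesis using q
  proof induction
    case (base x) then show ?case using 1[OF p] by simp
  next
    case (mult b c)
    have "p \<in> S" "b \<in> S" "c \<in> S" using mult sub p by auto
    then show ?case using mult.IH assoc by metis
  qed
qed

lemma mul3_commute:
  assumes X: "X \<subseteq> S" and comm: "\<And>x y. x \<in> X \<Longrightarrow> y \<in> X \<Longrightarrow> x \<cdot> y = y \<cdot> x"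
    and g: "p \<in> gen f X" "q \<in> gen f X" "opt_in (gen f X) w"
  shows "mul3 f p w q = mul3 f q w p"
proof (cases w)
  case None
  then show ?thesis using gen_commute[OF X comm g(1,2)] by (simp add: mul3_def)
next
  case (Some c)
  then have c: "c \<in> gen f X" using g by (simp add: opt_in_def)
  have S': "p \<in> S" "q \<in> S" "c \<in> S" using gen_sub[OF X] g c by auto
  have "p \<cdot> c \<cdot> q = q \<cdot> (p \<cdot> c)"
    by (rule gen_commute[OF X comm gen_closed[OF g(1) c] g(2)])
  also have "\<dots> = q \<cdot> (c \<cdot> p)" using gen_commute[OF X comm g(1) c] by simp
  also have "\<dots> = q \<cdot> c \<cdot> p" using S' by (simp add: assoc)
  finally show ?thesis by (simp add: Some mul3_def)
qed

lemma no_recurrent_commutative: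
  assumes X: "X \<subseteq> S" and comm: "\<And>x y. x \<in> X \<Longrightarrow> y \<in> X \<Longrightarrow> x \<cdot> y = y \<cdot> x"
    and B: "recurrent f (gen f X) Z B"
  shows "B = {}"
proof (rule ccontr)
  assume "B \<noteq> {}"
  then obtain p q where pq: "(p, q) \<in> B" by auto
  note D = recurrentD[OF B pq]
  obtain w where w: "opt_in (gen f X) w" "(mul3 f p w q, mul3 f q w p) \<in> B" using D(7) by blast
  show False using recurrentD(5)[OF B w(2)] mul3_commute[OF X comm D(1,2) w(1)] by blast
qed

text \<open>Modulo \<open>Z\<close> every element of \<open>gen f {x, y}\<close> outside \<open>gen f {x}\<close> annihilates everything on its left.\<close>
lemma no_recurrent_if_annihilated:
  assumes Z: "ideal S f Z" and xy: "x \<in> S" "y \<in> S" and xyZ: "x \<cdot> y \<in> Z" and yyZ: "y \<cdot> y \<in> Z"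
    and B: "recurrent f (gen f {x, y}) Z B"
  shows "B = {}"
proof (rule ccontr)
  assume "B \<noteq> {}"
  then obtain p q where pq: "(p, q) \<in> B" by auto
  note D = recurrentD[OF B pq]
  have sub: "gen f {x, y} \<subseteq> S" using xy by (intro gen_sub) auto
  \<comment> \<open>A product whose last factor is in \<open>N\<close> falls into \<open>Z\<close>.
    Since \<open>N\<close> contains y and absorbs factors on the right, elements of
    \<open>gen f {x, y}\<close> outside \<open>N\<close> are powers of x.\<close>
  define N where "N = {z \<in> S. \<forall>z'\<in>gen f {x, y}. z' \<cdot> z \<in> Z}"
  have ZN: "z \<in> N" if "z \<in> Z" for z using that Z sub by (auto simp: N_def ideal_def)
  have yN: "y \<in> N"
  proof -
    have "z' \<cdot> y \<in> Z" if "z' \<in> gen f {x, y}" for z'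
      using that
    proof induction
      case (base z) then show ?case using xyZ yyZ by auto
    next
      case (mult a b)
      then have "a \<in> S" "b \<in> S" using sub by auto
      then show ?case using mult Z xy by (simp add: assoc ideal_def)
    qed
    then show ?thesis using xy by (simp add: N_def)
  qed
  have NR: "z \<cdot> s \<in> N" if "z \<in> N" "s \<in> S" for z s
  proof -
    have "z' \<cdot> (z \<cdot> s) \<in> Z" if "z' \<in> gen f {x, y}" for z'
    proof -
      have "z' \<cdot> (z \<cdot> s) = z' \<cdot> z \<cdot> s" using that \<open>z \<in> N\<close> \<open>s \<in> S\<close> sub by (subst assoc) (auto simp: N_def)
      then show ?thesis using that \<open>z \<in> N\<close> \<open>s \<in> S\<close> Z by (auto simp: N_def ideal_def)
    qed
    then show ?thesis using that by (auto simp: N_def)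
  qed
  have dich: "z \<in> gen f {x} \<union> N" if "z \<in> gen f {x, y}" for z
    using that
  proof induction
    case (base z) then show ?case using yN by (auto intro: gen.base)
  next
    case (mult a b)
    have S': "a \<in> S" "b \<in> S" using mult sub by auto
    consider "a \<in> N" | "b \<in> N" | "a \<in> gen f {x}" "b \<in> gen f {x}" using mult by auto
    then show ?case
    proof cases
      case 1 then show ?thesis using NR S' by auto
    next
      case 2 then have "a \<cdot> b \<in> Z" using mult by (auto simp: N_def)
      then show ?thesis using ZN by auto
    next
      case 3 then show ?thesis by (auto intro: gen_closed)
    qed
  qed
  obtain w where w: "opt_in (gen f {x, y}) w" "(mul3 f p w q, mul3 f q w p) \<in> B" using D(7) by blast
  note D' = recurrentD[OF B w(2)]
  \<comment> \<open>If p, q or the middle factor were in \<open>N\<close>, one of the two products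
    would lie in \<open>Z\<close>. So all three are powers of x (or the identity) and
    commute.\<close>
  have last: "v \<notin> N" if "mul3 f u w v \<notin> Z" "u \<in> gen f {x, y}" "v \<in> gen f {x, y}" for u v
  proof (cases w)
    case (Some c)
    then have "u \<cdot> c \<in> gen f {x, y}" using w(1) that by (auto simp: opt_in_def intro: gen_closed)
    then show ?thesis using that Some by (auto simp: N_def mul3_def)
  qed (use that in \<open>auto simp: N_def mul3_def\<close>)
  have "p \<in> gen f {x}" "q \<in> gen f {x}"
    using last[of p q] last[of q p] D D' dich by auto
  moreover have "opt_in (gen f {x}) w"
  proof (cases w)
    case (Some c)
    have c: "c \<in> gen f {x, y}" using w(1) Some by (simp add: opt_in_def)
    have "c \<notin> N"
    proof
      assume "c \<in> N"
      then have "p \<cdot> c \<in> Z" using D by (auto simp: N_def)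
      then have "p \<cdot> c \<cdot> q \<in> Z" using Z D sub by (auto simp: ideal_def)
      then show False using D'(3) Some by (simp add: mul3_def)
    qed
    then show ?thesis using dich[OF c] Some by (simp add: opt_in_def)
  qed (simp add: opt_in_def)
  ultimately have "mul3 f p w q = mul3 f q w p" by (intro mul3_commute[of "{x}"]) (use xy in auto)
  then show False using D'(5) by blast
qed

text \<open>In a minimal subsemigroup E of the powers of \<open>a\<close> containing x, both xE and
  the stabiliser of all y with xy = x are subsemigroups, hence equal to E; so xx = x.\<close>

lemma idempotent_power:
  assumes a: "a \<in> S"
  obtains e where "e \<in> gen f {a}" "e \<cdot> e = e"
proof -
  define C where "C = {E. E \<subseteq> gen f {a} \<and> E \<noteq> {} \<and> (\<forall>x\<in>E. \<forall>y\<in>E. x \<cdot> y \<in> E)}"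
  have sub: "gen f {a} \<subseteq> S" using a by (intro gen_sub) auto
  have "gen f {a} \<in> C" using gen.base[of a "{a}" f] gen_closed by (auto simp: C_def)
  moreover have "finite C"
    by (rule finite_subset[of _ "Pow S"]) (use sub finite_S in \<open>auto simp: C_def\<close>)
  ultimately obtain E where E: "E \<in> C" and min: "\<And>E'. E' \<in> C \<Longrightarrow> E' \<subseteq> E \<Longrightarrow> E = E'"
    using finite_has_minimal[of C] by blast
  obtain x where x: "x \<in> E" using E by (auto simp: C_def)
  have inS: "y \<in> S" if "y \<in> E" for y using that E sub by (auto simp: C_def)
  have Ecl: "y \<cdot> z \<in> E" if "y \<in> E" "z \<in> E" for y z using that E by (auto simp: C_def)
  have "f x ` E \<in> C"
  proof -
    have "x \<cdot> y \<cdot> (x \<cdot> z) = x \<cdot> (y \<cdot> (x \<cdot> z))" if "y \<in> E" "z \<in> E" for y z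
      using that x inS by (simp add: assoc)
    then have "\<forall>u\<in>f x ` E. \<forall>v\<in>f x ` E. u \<cdot> v \<in> f x ` E" using x Ecl by auto
    moreover have "f x ` E \<subseteq> gen f {a}" using E x Ecl by (auto simp: C_def)
    ultimately show ?thesis using x by (auto simp: C_def)
  qed
  then have "E = f x ` E" using Ecl x by (intro min) auto
  then obtain y where y: "y \<in> E" "x \<cdot> y = x" using x by (metis imageE)
  have "{y \<in> E. x \<cdot> y = x} \<in> C"
  proof -
    have "x \<cdot> (y \<cdot> z) = x" if "y \<in> E" "z \<in> E" "x \<cdot> y = x" "x \<cdot> z = x" for y z
      using that x inS assoc by metis
    then show ?thesis using E x y Ecl by (auto simp: C_def)
  qed
  then have "E = {y \<in> E. x \<cdot> y = x}" by (intro min) auto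
  then have "x \<cdot> x = x" using x by blast
  then show thesis using that[of x] x E by (auto simp: C_def)
qed

end

text \<open>In the application \<open>A\<close> and \<open>Z\<close> are consecutive terms of the
  series. The last assumption says that b lies in \<open>S^1 a S^1\<close>; it is split into a left
  and a right factor so that one-sided classes can be read off from the intermediate
  element.\<close>

locale pn_block = pn_semigroup +
  fixes A Z :: "'a set"
  assumes ideal_A: "ideal S f A" and ideal_Z: "ideal S f Z" and ZA: "Z \<subseteq> A"
    and same_ideal: "\<And>a b. a \<in> A - Z \<Longrightarrow> b \<in> A - Z \<Longrightarrow> \<exists>c\<in>Ls S f a. b \<in> Rs S f c"
begin

abbreviation J :: "'a set" where "J \<equiv> A - Z"
abbreviation R :: "'a \<Rightarrow> 'a set" where "R \<equiv> Rs S f"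
abbreviation L :: "'a \<Rightarrow> 'a set" where "L \<equiv> Ls S f"

lemma dual: "pn_block S (\<lambda>x y. y \<cdot> x) A Z"
proof
  show "sgrp S (\<lambda>x y. y \<cdot> x)" "finite S" "pairs_inherit S (\<lambda>x y. y \<cdot> x)" "Z \<subseteq> A"
    using sgrp_dual sgrp finite_S pairs_inherit_dual inherit ZA by auto
  show "ideal S (\<lambda>x y. y \<cdot> x) A" "ideal S (\<lambda>x y. y \<cdot> x) Z" using iffD2[OF ideal_dual] ideal_A ideal_Z by blast+
  fix a b assume ab: "a \<in> J" "b \<in> J"
  then have aS: "a \<in> S" using ideal_A by (auto simp: ideal_def)
  obtain c where c: "c \<in> L a" "b \<in> R c" using same_ideal ab by blast
  consider "c = a" | s where "s \<in> S" "c = s \<cdot> a" using c by (auto simp: Rs_def)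
  then show "\<exists>c\<in>Rs S (\<lambda>x y. x \<cdot> y) a. b \<in> L c"
  proof cases
    case 1 then show ?thesis using c by (auto simp: Rs_def)
  next
    case 2
    consider "b = c" | t where "t \<in> S" "b = c \<cdot> t" using c by (auto simp: Rs_def)
    then show ?thesis
    proof cases
      case 1 then show ?thesis using 2 by (auto simp: Rs_def)
    next
      fix t assume "t \<in> S" "b = c \<cdot> t"
      then have "b = s \<cdot> (a \<cdot> t)" using 2 aS by (simp add: assoc)
      then show ?thesis using 2 \<open>t \<in> S\<close> by (auto simp: Rs_def)
    qed
  qed
qed

lemma J_S: "a \<in> J \<Longrightarrow> a \<in> S"
  using ideal_A by (auto simp: ideal_def)

lemma A_mult: "a \<in> A \<Longrightarrow> s \<in> S \<Longrightarrow> a \<cdot> s \<in> A" "a \<in> A \<Longrightarrow> s \<in> S \<Longrightarrow> s \<cdot> a \<in> A"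
  using ideal_A by (auto simp: ideal_def)

lemma Z_mult: "a \<in> Z \<Longrightarrow> s \<in> S \<Longrightarrow> a \<cdot> s \<in> Z" "a \<in> Z \<Longrightarrow> s \<in> S \<Longrightarrow> s \<cdot> a \<in> Z"
  using ideal_Z by (auto simp: ideal_def)

lemma J_left_factor: "a \<cdot> s \<in> J \<Longrightarrow> a \<in> A \<Longrightarrow> s \<in> S \<Longrightarrow> a \<in> J"
  using Z_mult by auto

lemma J_right_factor: "s \<cdot> a \<in> J \<Longrightarrow> a \<in> A \<Longrightarrow> s \<in> S \<Longrightarrow> a \<in> J"
  using Z_mult by auto

text \<open>Stability of finite semigroups: left translation maps \<open>R b\<close> onto a set containing \<open>R a\<close>.\<close>
lemma R_eq:
  assumes a: "a \<in> J" and b: "b \<in> J" and ba: "b \<in> R a"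
  shows "R b = R a"
proof (rule card_subset_eq)
  note S' = J_S[OF a] J_S[OF b]
  show "finite (R a)" using finite_S by (simp add: Rs_def)
  show sub: "R b \<subseteq> R a" using Rs_trans S' ba by blast
  obtain c where c: "c \<in> L b" "a \<in> R c" using same_ideal a b by blast
  have finb: "finite (R b)" using finite_S by (simp add: Rs_def)
  have "\<exists>h. R a \<subseteq> h ` R b"
  proof (cases "c = b")
    case True
    then have "R a \<subseteq> id ` R b" using Rs_trans[of b a] c S' by simp
    then show ?thesis by blast
  next
    case False
    then obtain s where s: "s \<in> S" "c = s \<cdot> b" using c by (auto simp: Rs_def)
    have "R a \<subseteq> R c" using Rs_trans[of c a] c S' s by auto
    also have "\<dots> \<subseteq> f s ` R b" using s S' by (auto simp: Rs_def assoc image_iff)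
    finally show ?thesis by blast
  qed
  then obtain h where "R a \<subseteq> h ` R b" by blast
  then have "card (R a) \<le> card (R b)"
    using finb by (meson card_image_le card_mono finite_imageI le_trans)
  then show "card (R b) = card (R a)"
    using card_mono[OF \<open>finite (R a)\<close> sub] by simp
qed

lemma L_eq: "a \<in> J \<Longrightarrow> b \<in> J \<Longrightarrow> b \<in> L a \<Longrightarrow> L b = L a"
  by (rule pn_block.R_eq[OF dual])

lemma R_mult: "a \<in> J \<Longrightarrow> s \<in> S \<Longrightarrow> a \<cdot> s \<in> J \<Longrightarrow> R (a \<cdot> s) = R a"
  by (rule R_eq) (auto simp: Rs_def)

lemma L_mult: "a \<in> J \<Longrightarrow> s \<in> S \<Longrightarrow> s \<cdot> a \<in> J \<Longrightarrow> L (s \<cdot> a) = L a"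
  by (rule L_eq) (auto simp: Rs_def)

text \<open>Were uv in the ideal \<open>Z\<close>, so would be every suvt, and elements of the
  classes of u and v have the forms su and vt. Thus membership of a product in \<open>J\<close>
  depends only on the L-class of the left factor and the R-class of the right one.\<close>

lemma mult_J_cong:
  assumes "u \<in> J" "v \<in> J" "u' \<in> J" "v' \<in> J" "L u = L u'" "R v = R v'" "u' \<cdot> v' \<in> J"
  shows "u \<cdot> v \<in> J"
proof -
  note S' = assms(1-4)[THEN J_S]
  have uv: "u \<cdot> v \<in> A" using assms A_mult S' by auto
  have u': "u' \<in> L u" "v' \<in> R v" using assms Rs_self by metis+
  have "u \<cdot> v \<notin> Z"
  proof
    assume Z: "u \<cdot> v \<in> Z"
    consider "u' = u" | s where "s \<in> S" "u' = s \<cdot> u" using u' by (auto simp: Rs_def)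
    then have Z1: "u' \<cdot> v \<in> Z"
    proof cases
      case 2 then show ?thesis using Z Z_mult S' by (simp add: assoc)
    qed (use Z in simp)
    consider "v' = v" | s where "s \<in> S" "v' = v \<cdot> s" using u' by (auto simp: Rs_def)
    then have "u' \<cdot> v' \<in> Z"
    proof cases
      case 2
      then have "u' \<cdot> v' = u' \<cdot> v \<cdot> s" using S' by (simp add: assoc)
      then show ?thesis using Z1 Z_mult 2 by simp
    qed (use Z1 in simp)
    then show False using assms by simp
  qed
  then show ?thesis using uv by simp
qed

text \<open>The intermediate element in \<open>same_ideal\<close> is outside \<open>Z\<close>
  because its multiple \<open>a\<close> is, so it lies in \<open>J\<close> and stability puts it in
  both classes.\<close>

lemma class_intersection:
  assumes "a \<in> J" "b \<in> J"
  obtains x where "x \<in> J" "R x = R a" "L x = L b"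
proof -
  obtain c where c: "c \<in> L b" "a \<in> R c" using same_ideal assms by blast
  have cA: "c \<in> A" using c(1) assms A_mult by (auto simp: Rs_def)
  have "c \<notin> Z" using c(2) assms Z_mult by (auto simp: Rs_def)
  then have "c \<in> J" using cA by simp
  then show thesis using that[of c] R_eq[of c a] L_eq[of b c] c assms by simp
qed

text \<open>As pw is L-related to w, the product (pw)q stays in \<open>J\<close> because wq
  does.\<close>

lemma mul3_J:
  assumes "p \<in> J" "w \<in> J" "q \<in> J" "p \<cdot> w \<in> J" "w \<cdot> q \<in> J"
  shows "p \<cdot> w \<cdot> q \<in> J" "R (p \<cdot> w \<cdot> q) = R p" "L (p \<cdot> w \<cdot> q) = L q"
proof -
  note S' = assms(1-3)[THEN J_S]
  have "L (p \<cdot> w) = L w" using assms S' by (intro L_mult) auto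
  then show 1: "p \<cdot> w \<cdot> q \<in> J" using mult_J_cong[of "p \<cdot> w" q w q] assms by simp
  then show "L (p \<cdot> w \<cdot> q) = L q" using L_mult assms S' by simp
  show "R (p \<cdot> w \<cdot> q) = R p" using 1 R_mult[of "p" "w \<cdot> q"] assms S' by (simp add: assoc)
qed

text \<open>From p in \<open>S^1 cd S^1\<close> one gets p = c'd' with both factors in
  \<open>J\<close>. Then c' is R-related and d' is L-related to p, so c' = ps and d' = tp, whence p
  = p(st)p; the cases arise from the adjoined identity.\<close>

lemma regular:
  assumes cd: "c \<in> J" "d \<in> J" "c \<cdot> d \<in> J" and p: "p \<in> J"
  obtains u where "u \<in> S" "p \<cdot> u \<cdot> p = p"
proof -
  obtain k where k: "k \<in> L (c \<cdot> d)" "p \<in> R k" using same_ideal cd(3) p by blast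
  note S' = cd[THEN J_S] p[THEN J_S]
  obtain c' where c': "c' \<in> A" "k = c' \<cdot> d"
  proof -
    consider "k = c \<cdot> d" | s where "s \<in> S" "k = s \<cdot> (c \<cdot> d)" using k(1) by (auto simp: Rs_def)
    then show thesis
    proof cases
      case 1 then show thesis using that[of c] cd by auto
    next
      case 2 then show thesis using that[of "s \<cdot> c"] cd A_mult S' by (auto simp: assoc)
    qed
  qed
  have c'S: "c' \<in> S" using c' ideal_A by (auto simp: ideal_def)
  obtain d' where d': "d' \<in> A" "p = c' \<cdot> d'"
    using k(2) c' c'S cd S' A_mult by (auto simp: Rs_def assoc)
  have d'S: "d' \<in> S" using d' ideal_A by (auto simp: ideal_def)
  have J': "c' \<in> J" "d' \<in> J" using d' c' p Z_mult c'S d'S by auto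
  have "R p = R c'" "L p = L d'" using R_mult[of c' d'] L_mult[of d' c'] J' d' p c'S d'S by auto
  then have c'': "c' \<in> R p" and d'': "d' \<in> L p" using Rs_self by metis+
  consider "c' = p" | s where "s \<in> S" "c' = p \<cdot> s" using c'' by (auto simp: Rs_def)
  then show thesis
  proof cases
    case 1
    consider "d' = p" | t where "t \<in> S" "d' = t \<cdot> p" using d'' by (auto simp: Rs_def)
    then show thesis
    proof cases
      case a: 1
      have "p \<cdot> p \<cdot> p = p" using 1 a d'(2) by metis
      then show thesis using that[of p] S' by blast
    next
      fix t assume t: "t \<in> S" "d' = t \<cdot> p"
      have "p \<cdot> t \<cdot> p = p" using 1 t d'(2) assoc S' by metis
      then show thesis using that[of t] t by blast
    qed
  next
    case 2
    consider "d' = p" | t where "t \<in> S" "d' = t \<cdot> p" using d'' by (auto simp: Rs_def)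
    then show thesis
    proof cases
      case 1
      have "p \<cdot> s \<cdot> p = p" using 1 2 d'(2) by metis
      then show thesis using that[of s] 2 by blast
    next
      fix t assume t: "t \<in> S" "d' = t \<cdot> p"
      have "p \<cdot> (s \<cdot> t) \<cdot> p = c' \<cdot> d'" using 2 t S' by (simp add: assoc)
      then show thesis using that[of "s \<cdot> t"] t 2 d'(2) by (metis closed)
    qed
  qed
qed

section \<open>Products that stay in the block\<close>

text \<open>Suppose the fourth product fails. Take x and y in the L-class of u1 and the R-classes of
  v1 and v2. The three given products make (x, y) recurrent with a middle factor from the R-class of
  v1 and the L-class of u2. But xy and yy fall into \<open>Z\<close>, which
  \<open>no_recurrent_if_annihilated\<close> forbids.\<close>

lemma three_products:
  assumes J': "u1 \<in> J" "u2 \<in> J" "v1 \<in> J" "v2 \<in> J"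
    and "u1 \<cdot> v1 \<in> J" "u2 \<cdot> v1 \<in> J" "u2 \<cdot> v2 \<in> J"
  shows "u1 \<cdot> v2 \<in> J"
proof (rule ccontr)
  assume no: "u1 \<cdot> v2 \<notin> J"
  obtain x where x: "x \<in> J" "R x = R v1" "L x = L u1" by (rule class_intersection[OF J'(3) J'(1)])
  obtain y where y: "y \<in> J" "R y = R v2" "L y = L u1" by (rule class_intersection[OF J'(4) J'(1)])
  obtain w where w: "w \<in> J" "R w = R v1" "L w = L u2" by (rule class_intersection[OF J'(3) J'(2)])
  define B0 where "B0 = {(p, q). p \<in> J \<and> q \<in> J \<and> R p = R v1 \<and> L p = L u1 \<and> R q = R v2 \<and> L q = L u1}"
  have ne: "R v1 \<noteq> R v2" using no mult_J_cong[of u1 v2 u1 v1] assms by auto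
  have step: "(p \<cdot> w \<cdot> q, q \<cdot> w \<cdot> p) \<in> B0" if "(p, q) \<in> B0" for p q
  proof -
    have pq: "p \<in> J" "q \<in> J" "R p = R v1" "L p = L u1" "R q = R v2" "L q = L u1"
      using that by (auto simp: B0_def)
    have "p \<cdot> w \<in> J" "w \<cdot> q \<in> J" "q \<cdot> w \<in> J" "w \<cdot> p \<in> J"
      using mult_J_cong[of p w u1 v1] mult_J_cong[of w q u2 v2] mult_J_cong[of q w u1 v1]
        mult_J_cong[of w p u2 v1] pq w assms by auto
    then show ?thesis using mul3_J[of p w q] mul3_J[of q w p] pq w by (simp add: B0_def)
  qed
  have rec: "recurrent f S Z (B0 \<union> B0\<inverse>)" unfolding recurrent_def
  proof (intro conjI allI impI)
    show "sym (B0 \<union> B0\<inverse>)" by (simp add: sym_Un_converse)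
    fix p q assume "(p, q) \<in> B0 \<union> B0\<inverse>"
    then have pq: "(p, q) \<in> B0 \<or> (q, p) \<in> B0" by auto
    then show "p \<in> S - Z" "q \<in> S - Z" "p \<noteq> q" using ne J_S by (auto simp: B0_def)
    have "opt_in S (Some w)" using w J_S by (simp add: opt_in_def)
    then show "\<exists>w. opt_in S w \<and> (mul3 f p w q, mul3 f q w p) \<in> B0 \<union> B0\<inverse>"
      using step pq by (intro exI[of _ "Some w"]) (auto simp: mul3_def)
  qed
  have xy: "(x, y) \<in> B0 \<union> B0\<inverse>" using x y by (simp add: B0_def)
  obtain B' where B': "B' \<noteq> {}" "recurrent f (gen f {x, y}) Z B'"
    by (rule inheritD[OF ideal_Z rec xy])
  have "x \<cdot> y \<notin> J" "y \<cdot> y \<notin> J"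
    using no mult_J_cong[of u1 v2 x y] mult_J_cong[of u1 v2 y y] x y J' by auto
  then have Z: "x \<cdot> y \<in> Z" "y \<cdot> y \<in> Z" using A_mult x y J_S by auto
  show False
    using no_recurrent_if_annihilated[OF ideal_Z x(1)[THEN J_S] y(1)[THEN J_S] Z B'(2)] B'(1) by simp
qed

text \<open>Right translation by \<open>u\<close> with \<open>pup = p\<close> carries the recurrent set to one containing \<open>(pu, qu)\<close>;
  since \<open>pu\<close> is an identity for \<open>qu\<close>, these two elements generate a commutative semigroup.\<close>
lemma no_recurrent_in_H_class:
  assumes cd: "c \<in> J" "d \<in> J" "c \<cdot> d \<in> J"
    and B: "recurrent f S Z B"
    and H: "\<And>p q. (p, q) \<in> B \<Longrightarrow> p \<in> J \<and> q \<in> J \<and> R p = R q \<and> L p = L q"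
  shows "B = {}"
proof (rule ccontr)
  assume "B \<noteq> {}"
  then obtain p q where pq: "(p, q) \<in> B" by auto
  have pJ: "p \<in> J" "q \<in> J" "R p = R q" "L p = L q" using H[OF pq] by auto
  note pS = pJ(1,2)[THEN J_S]
  obtain u where u: "u \<in> S" "p \<cdot> u \<cdot> p = p" by (rule regular[OF cd pJ(1)])
  have zup: "z \<cdot> u \<cdot> p = z" if "z \<in> J" "L z = L p" for z
  proof -
    have "z \<in> L p" using that Rs_self by metis
    then consider "z = p" | s where "s \<in> S" "z = s \<cdot> p" by (auto simp: Rs_def)
    then show ?thesis
    proof cases
      case 2
      then have "z \<cdot> u \<cdot> p = s \<cdot> (p \<cdot> u \<cdot> p)" using u pS by (simp add: assoc)
      then show ?thesis using u 2 by simp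
    qed (use u in simp)
  qed
  have epz: "p \<cdot> u \<cdot> z = z" if "z \<in> J" "R z = R p" for z
  proof -
    have "z \<in> R p" using that Rs_self by metis
    then consider "z = p" | s where "s \<in> S" "z = p \<cdot> s" by (auto simp: Rs_def)
    then show ?thesis
    proof cases
      case 2
      then have "p \<cdot> u \<cdot> z = p \<cdot> u \<cdot> p \<cdot> s" using u pS assoc[of "p \<cdot> u" p s] by simp
      then show ?thesis using u 2 by simp
    qed (use u in simp)
  qed
  \<comment> \<open>Only pairs in the H-class of p are translated: there multiplication by p undoes
    the translation, which keeps the pairs unequal and outside \<open>Z\<close>.\<close>
  define B' where "B' = {(z \<cdot> u, z' \<cdot> u) | z z'. (z, z') \<in> B \<and> R z = R p \<and> L z = L p}"
  have rec: "recurrent f S Z B'" unfolding recurrent_def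
  proof (intro conjI allI impI)
    show "sym B'"
    proof (rule symI)
      fix a b assume "(a, b) \<in> B'"
      then obtain z z' where z: "a = z \<cdot> u" "b = z' \<cdot> u" "(z, z') \<in> B" "R z = R p" "L z = L p"
        by (auto simp: B'_def)
      then show "(b, a) \<in> B'" using H[OF z(3)] recurrentD(6)[OF B z(3)] unfolding B'_def by auto
    qed
    fix a b assume "(a, b) \<in> B'"
    then obtain z z' where z: "a = z \<cdot> u" "b = z' \<cdot> u" "(z, z') \<in> B" "R z = R p" "L z = L p"
      by (auto simp: B'_def)
    have zJ: "z \<in> J" "z' \<in> J" "R z' = R p" "L z' = L p" using H[OF z(3)] z by auto
    note zS = zJ(1,2)[THEN J_S]
    have zp: "a \<cdot> p = z" "b \<cdot> p = z'" using zup zJ z by auto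
    have "a \<notin> Z" "b \<notin> Z" using zp zJ Z_mult pS by auto
    then show "a \<in> S - Z" "b \<in> S - Z" using z zS u by auto
    show "a \<noteq> b" using zp recurrentD(5)[OF B z(3)] by auto
    obtain w where w: "opt_in S w" "(mul3 f z w z', mul3 f z' w z) \<in> B"
      using recurrentD(7)[OF B z(3)] by blast
    \<comment> \<open>Since zup = z, this middle factor satisfies (zu)v(z'u) = (zwz')u, so steps
      translate along; the identity is replaced by p.\<close>
    define v where "v = (case w of None \<Rightarrow> p | Some c \<Rightarrow> p \<cdot> c)"
    have vS: "v \<in> S" using w(1) pS by (auto simp: v_def opt_in_def split: option.splits)
    have step: "z1 \<cdot> u \<cdot> v \<cdot> (z2 \<cdot> u) = mul3 f z1 w z2 \<cdot> u"
      if "z1 \<in> J" "L z1 = L p" "z2 \<in> J" for z1 z2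
    proof (cases w)
      case None
      then show ?thesis using zup[of z1] that J_S u by (simp add: v_def mul3_def assoc)
    next
      case (Some c)
      then have c: "c \<in> S" using w(1) by (simp add: opt_in_def)
      have "z1 \<cdot> u \<cdot> (p \<cdot> c) \<cdot> (z2 \<cdot> u) = z1 \<cdot> u \<cdot> p \<cdot> c \<cdot> z2 \<cdot> u"
        using that c u pS J_S by (simp add: assoc)
      then show ?thesis using zup[of z1] that by (simp add: v_def mul3_def Some)
    qed
    have mJ: "mul3 f z w z' \<in> J" using H[OF w(2)] by blast
    have "R (mul3 f z w z') = R z"
    proof (cases w)
      case None then show ?thesis using mJ R_mult zJ zS by (simp add: mul3_def)
    next
      case (Some c)
      then have "c \<in> S" using w(1) by (simp add: opt_in_def)
      then show ?thesis using mJ R_mult[of z "c \<cdot> z'"] zJ zS by (simp add: mul3_def Some assoc)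
    qed
    moreover have "L (mul3 f z w z') = L z'"
    proof (cases w)
      case None then show ?thesis using mJ L_mult zJ zS by (simp add: mul3_def)
    next
      case (Some c)
      then have "c \<in> S" using w(1) by (simp add: opt_in_def)
      then show ?thesis using mJ L_mult[of z' "z \<cdot> c"] zJ zS by (simp add: mul3_def Some)
    qed
    ultimately have "(mul3 f z w z' \<cdot> u, mul3 f z' w z \<cdot> u) \<in> B'"
      unfolding B'_def using w(2) z zJ by auto
    then show "\<exists>w. opt_in S w \<and> (mul3 f a w b, mul3 f b w a) \<in> B'"
      using step[of z z'] step[of z' z] z zJ vS
      by (intro exI[of _ "Some v"]) (simp add: mul3_def opt_in_def)
  qed
  have in': "(p \<cdot> u, q \<cdot> u) \<in> B'" unfolding B'_def using pq by auto
  obtain C where C: "C \<noteq> {}" "recurrent f (gen f {p \<cdot> u, q \<cdot> u}) Z C"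
    by (rule inheritD[OF ideal_Z rec in'])
  have "p \<cdot> u \<cdot> (q \<cdot> u) = q \<cdot> u"
    using epz[of q] pJ pS u assoc[of "p \<cdot> u" q u] by simp
  moreover have "q \<cdot> u \<cdot> (p \<cdot> u) = q \<cdot> u"
    using zup[of q] pJ pS u assoc[of "q \<cdot> u" p u] by simp
  ultimately have "C = {}"
    using pS u by (intro no_recurrent_commutative[OF _ _ C(2)]) auto
  then show False using C(1) by simp
qed

lemma A_S: "A \<subseteq> S"
  using ideal_A by (auto simp: ideal_def)

lemma nonnull:
  assumes B: "recurrent f A Z B" and pq: "(p, q) \<in> B"
  obtains c d where "c \<in> J" "d \<in> J" "c \<cdot> d \<in> J"
proof -
  note D = recurrentD[OF B pq]
  obtain w where w: "opt_in A w" "(mul3 f p w q, mul3 f q w p) \<in> B" using D(7) by blast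
  note D' = recurrentD(1,3)[OF B w(2)]
  show thesis
  proof (cases w)
    case None then show thesis using that[of p q] D D' by (simp add: mul3_def)
  next
    case (Some c)
    then have c: "c \<in> A" using w(1) by (simp add: opt_in_def)
    have "p \<cdot> c \<notin> Z" using D' Z_mult(1)[of "p \<cdot> c" q] D A_S Some by (auto simp: mul3_def)
    then show thesis using that[of p c] c D A_S A_mult Z_mult(2)[of c p] by auto
  qed
qed

text \<open>A middle factor c in a step from (p, q) occurs in front of both q and p. If the step is
  taken with the identity, the pair becomes (pq, qp), and the next step yields either such a c or
  the product qq, in which case q itself serves.\<close>

lemma common_left_factor:
  assumes B: "recurrent f A Z B" and pq: "(p, q) \<in> B"
  obtains g where "g \<in> J" "g \<cdot> p \<in> J" "g \<cdot> q \<in> J"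
proof -
  note D = recurrentD[OF B pq]
  have S': "p \<in> S" "q \<in> S" using D A_S by auto
  obtain w where w: "opt_in A w" "(mul3 f p w q, mul3 f q w p) \<in> B" using D(7) by blast
  note D' = recurrentD[OF B w(2)]
  note concl = that
  have fin: thesis if g: "g \<in> A" "g \<cdot> p \<notin> Z" "g \<cdot> q \<notin> Z" for g
  proof -
    have "g \<notin> Z" using g Z_mult S' by blast
    moreover have "g \<cdot> p \<in> A" "g \<cdot> q \<in> A" using A_mult g S' by auto
    ultimately show thesis using concl[of g] g by blast
  qed
  show thesis
  proof (cases w)
    case (Some c)
    then have c: "c \<in> A" "c \<in> S" using w(1) A_S by (auto simp: opt_in_def)
    have "p \<cdot> (c \<cdot> q) \<notin> Z" "q \<cdot> (c \<cdot> p) \<notin> Z"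
      using D'(3,4) S' c by (simp_all add: Some mul3_def assoc)
    then show thesis using fin[of c] c S' Z_mult by blast
  next
    case None
    then have in1: "(p \<cdot> q, q \<cdot> p) \<in> B" using w(2) by (simp add: mul3_def)
    note E = recurrentD[OF B in1]
    obtain v where v: "opt_in A v" "(mul3 f (p \<cdot> q) v (q \<cdot> p), mul3 f (q \<cdot> p) v (p \<cdot> q)) \<in> B"
      using E(7) by blast
    note E' = recurrentD(3,4)[OF B v(2)]
    show thesis
    proof (cases v)
      case None
      then have "p \<cdot> (q \<cdot> q \<cdot> p) \<notin> Z" using E'(1) S' by (simp add: mul3_def assoc)
      then have "q \<cdot> q \<notin> Z" using Z_mult S' by blast
      then show thesis using fin[of q] D(2) E(4) by blast
    next
      case (Some c)
      then have c: "c \<in> A" "c \<in> S" using v(1) A_S by (auto simp: opt_in_def)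
      have "p \<cdot> q \<cdot> (c \<cdot> q \<cdot> p) \<notin> Z" "q \<cdot> p \<cdot> (c \<cdot> p \<cdot> q) \<notin> Z"
        using E' S' c by (simp_all add: Some mul3_def assoc)
      then have "c \<cdot> q \<notin> Z" "c \<cdot> p \<notin> Z" using Z_mult S' closed by blast+
      then show thesis using fin[of c] c by blast
    qed
  qed
qed

lemma J_multI: "a \<in> A \<Longrightarrow> s \<in> S \<Longrightarrow> a \<cdot> s \<notin> Z \<Longrightarrow> a \<cdot> s \<in> J" "a \<in> A \<Longrightarrow> s \<in> S \<Longrightarrow> s \<cdot> a \<notin> Z \<Longrightarrow> s \<cdot> a \<in> J"
  using A_mult by auto

text \<open>If the R-classes of p and q differed, failure of closure would give an L-class whose
  products with both classes fall into \<open>Z\<close>. Elements x and y of that L-class in the two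
  R-classes generate a null semigroup modulo \<open>Z\<close>, yet a suitable middle factor makes
  (x, y) recurrent.\<close>

lemma nonclosed_pairs_R:
  assumes uv: "u0 \<in> J" "v0 \<in> J" "u0 \<cdot> v0 \<notin> J"
    and B: "recurrent f A Z B" and pq: "(p, q) \<in> B"
  shows "R p = R q"
proof (rule ccontr)
  assume ne: "R p \<noteq> R q"
  obtain c d where cd: "c \<in> J" "d \<in> J" "c \<cdot> d \<in> J" by (rule nonnull[OF B pq])
  obtain g where g: "g \<in> J" "g \<cdot> p \<in> J" "g \<cdot> q \<in> J" by (rule common_left_factor[OF B pq])
  have pJ: "p \<in> J" "q \<in> J" using recurrentD[OF B pq] by auto
  have left: "\<exists>k\<in>J. k \<cdot> v \<in> J" and right: "\<exists>k\<in>J. v \<cdot> k \<in> J" if v: "v \<in> J" for v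
  proof -
    obtain u where u: "u \<in> S" "v \<cdot> u \<cdot> v = v" by (rule regular[OF cd v])
    have vS: "v \<in> S" using v J_S by auto
    have a: "v \<cdot> (u \<cdot> v) = v" using u vS assoc by simp
    have "v \<cdot> u \<in> J" "u \<cdot> v \<in> J"
      using J_multI[of v u] v u vS Z_mult(1)[of "v \<cdot> u" v] Z_mult(2)[of "u \<cdot> v" v] a by auto
    then show "\<exists>k\<in>J. k \<cdot> v \<in> J" "\<exists>k\<in>J. v \<cdot> k \<in> J" using u v a by metis+
  qed
  obtain x0 where x0: "x0 \<in> J" "x0 \<cdot> p \<notin> J"
  proof -
    obtain k where k: "k \<in> J" "k \<cdot> v0 \<in> J" using left uv by blast
    show thesis
    proof (rule ccontr)
      \<comment> \<open>Otherwise p is a common right partner of u0 and k; with k v0 in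
        \<open>J\<close>, \<open>three_products\<close> puts u0 v0 into \<open>J\<close>.\<close>
      assume "\<not> thesis"
      then have all: "\<And>x. x \<in> J \<Longrightarrow> x \<cdot> p \<in> J" using that by blast
      show False using three_products[OF uv(1) k(1) pJ(1) uv(2)] all uv k by blast
    qed
  qed
  \<comment> \<open>The common left factor g ties p and q together: x0 q in \<open>J\<close> would
    imply x0 p in \<open>J\<close>.\<close>
  have x0q: "x0 \<cdot> q \<notin> J" using three_products[OF x0(1) g(1) pJ(2) pJ(1)] g x0 by blast
  obtain d where d: "d \<in> J" "x0 \<cdot> d \<in> J" using right x0 by blast
  obtain x where x: "x \<in> J" "R x = R p" "L x = L x0" by (rule class_intersection[OF pJ(1) x0(1)])
  obtain y where y: "y \<in> J" "R y = R q" "L y = L x0" by (rule class_intersection[OF pJ(2) x0(1)])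
  \<comment> \<open>The R-class of d lets members of the L-class of x0 stand on the left of w; the
    L-class of g lets both R-classes stand on its right.\<close>
  obtain w where w: "w \<in> J" "R w = R d" "L w = L g" by (rule class_intersection[OF d(1) g(1)])
  define B0 where "B0 = {(s, t). s \<in> J \<and> t \<in> J \<and> R s = R p \<and> L s = L x0 \<and> R t = R q \<and> L t = L x0}"
  have step: "(s \<cdot> w \<cdot> t, t \<cdot> w \<cdot> s) \<in> B0" if "(s, t) \<in> B0" for s t
  proof -
    have st: "s \<in> J" "t \<in> J" "R s = R p" "L s = L x0" "R t = R q" "L t = L x0"
      using that by (auto simp: B0_def)
    have "s \<cdot> w \<in> J" "w \<cdot> t \<in> J" "t \<cdot> w \<in> J" "w \<cdot> s \<in> J"
      using mult_J_cong[of s w x0 d] mult_J_cong[of w t g q] mult_J_cong[of t w x0 d]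
        mult_J_cong[of w s g p] st w x0 g d pJ by auto
    then show ?thesis using mul3_J[of s w t] mul3_J[of t w s] st w by (simp add: B0_def)
  qed
  have rec: "recurrent f S Z (B0 \<union> B0\<inverse>)" unfolding recurrent_def
  proof (intro conjI allI impI)
    show "sym (B0 \<union> B0\<inverse>)" by (simp add: sym_Un_converse)
    fix s t assume "(s, t) \<in> B0 \<union> B0\<inverse>"
    then have st: "(s, t) \<in> B0 \<or> (t, s) \<in> B0" by auto
    then show "s \<in> S - Z" "t \<in> S - Z" "s \<noteq> t" using ne J_S by (auto simp: B0_def)
    have "opt_in S (Some w)" using w J_S by (simp add: opt_in_def)
    then show "\<exists>w. opt_in S w \<and> (mul3 f s w t, mul3 f t w s) \<in> B0 \<union> B0\<inverse>"
      using step st by (intro exI[of _ "Some w"]) (auto simp: mul3_def)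
  qed
  have xy: "(x, y) \<in> B0 \<union> B0\<inverse>" using x y by (simp add: B0_def)
  obtain B' where B': "B' \<noteq> {}" "recurrent f (gen f {x, y}) Z B'"
    by (rule inheritD[OF ideal_Z rec xy])
  have "x \<cdot> y \<notin> J" "y \<cdot> y \<notin> J"
    using x0q mult_J_cong[of x0 q x y] mult_J_cong[of x0 q y y] x y x0 pJ by auto
  then have Z: "x \<cdot> y \<in> Z" "y \<cdot> y \<in> Z" using A_mult x y J_S by auto
  show False
    using no_recurrent_if_annihilated[OF ideal_Z x(1)[THEN J_S] y(1)[THEN J_S] Z B'(2)] B'(1) by simp
qed

end

section \<open>Non-nilpotent principal factors\<close>

locale nonnil_block = pn_block +
  assumes recurrent_pairs: "\<exists>B. B \<noteq> {} \<and> recurrent f A Z B"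
begin

lemma nonnil_dual: "nonnil_block S (\<lambda>x y. y \<cdot> x) A Z"
proof -
  obtain B where "B \<noteq> {}" "recurrent f A Z B" using recurrent_pairs by auto
  then have "\<exists>B. B \<noteq> {} \<and> recurrent (\<lambda>x y. y \<cdot> x) A Z B" using recurrent_dual[OF sgrp A_S, of Z B] by auto
  then show ?thesis using dual by (simp add: nonnil_block_def nonnil_block_axioms_def)
qed

lemma not_all_H_related:
  "\<exists>p\<in>J. \<exists>q\<in>J. R p \<noteq> R q \<or> L p \<noteq> L q"
proof (rule ccontr)
  assume no: "\<not> ?thesis"
  obtain B p q where B: "recurrent f A Z B" and pq: "(p, q) \<in> B" using recurrent_pairs by auto
  obtain c d where cd: "c \<in> J" "d \<in> J" "c \<cdot> d \<in> J" by (rule nonnull[OF B pq])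
  have "B = {}"
  proof (rule no_recurrent_in_H_class[OF cd recurrent_mono[OF B A_S]])
    fix p q assume "(p, q) \<in> B"
    then show "p \<in> J \<and> q \<in> J \<and> R p = R q \<and> L p = L q" using recurrentD(1-4)[OF B] no by blast
  qed
  then show False using pq by simp
qed

text \<open>Without closure, \<open>nonclosed_pairs_R\<close> and its dual force every recurrent
  pair into a single H-class, which \<open>no_recurrent_in_H_class\<close> excludes.\<close>

lemma J_mult: assumes uv: "u \<in> J" "v \<in> J" shows "u \<cdot> v \<in> J"
proof (rule ccontr)
  assume no: "u \<cdot> v \<notin> J"
  obtain B p q where B: "recurrent f A Z B" and pq: "(p, q) \<in> B" using recurrent_pairs by auto
  obtain c d where cd: "c \<in> J" "d \<in> J" "c \<cdot> d \<in> J" by (rule nonnull[OF B pq])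
  have "B = {}"
  proof (rule no_recurrent_in_H_class[OF cd recurrent_mono[OF B A_S]])
    fix p q assume pq: "(p, q) \<in> B"
    have "R p = R q" by (rule nonclosed_pairs_R[OF uv no B pq])
    moreover have "L p = L q"
      by (rule pn_block.nonclosed_pairs_R[OF dual uv(2,1) no recurrent_dual[OF sgrp A_S B] pq])
    ultimately show "p \<in> J \<and> q \<in> J \<and> R p = R q \<and> L p = L q" using recurrentD(1-4)[OF B pq] by auto
  qed
  then show False using pq by simp
qed

section \<open>Stems as complements of prime ideals\<close>

text \<open>This is \<open>Sstar\<close> for a non-nilpotent factor, without treating
  \<open>A\<close> separately: closure puts \<open>J\<close> in, and elements of \<open>Z\<close>
  cannot satisfy the condition.\<close>

definition stem :: "'a set" where
  "stem = {s \<in> S. \<exists>t\<in>J. s \<cdot> t \<in> J \<or> t \<cdot> s \<in> J}"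

lemma stem_S: "s \<in> stem \<Longrightarrow> s \<in> S"
  by (simp add: stem_def)

text \<open>By closure t'(st) is in \<open>J\<close>, so its factor t's is not in \<open>Z\<close>.
  One product inside \<open>J\<close> on one side thus forces all products on the other side, and
  duality leads back.\<close>

lemma mult_left_all:
  assumes "s \<in> S" "t \<in> J" "s \<cdot> t \<in> J" "t' \<in> J" shows "t' \<cdot> s \<in> J"
proof -
  have "t' \<cdot> s \<cdot> t \<in> J" using J_mult[of t' "s \<cdot> t"] assms J_S by (simp add: assoc)
  then show ?thesis using assms J_S A_mult(1)[of t' s] J_left_factor[of "t' \<cdot> s" t] by blast
qed

lemma mult_right_all: "s \<in> S \<Longrightarrow> t \<in> J \<Longrightarrow> t \<cdot> s \<in> J \<Longrightarrow> t' \<in> J \<Longrightarrow> s \<cdot> t' \<in> J"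
  by (rule nonnil_block.mult_left_all[OF nonnil_dual])

lemma stemD: assumes "s \<in> stem" "t \<in> J" shows "s \<cdot> t \<in> J" "t \<cdot> s \<in> J"
  using assms mult_left_all[of s] mult_right_all[of s] unfolding stem_def by blast+

lemma J_nonempty: obtains t where "t \<in> J"
  using not_all_H_related by blast

lemma J_stem: "J \<subseteq> stem"
  using J_mult J_S unfolding stem_def by blast

lemma stem_Z: "stem \<inter> Z = {}"
  using Z_mult J_S unfolding stem_def by blast

lemma stem_mult: assumes "x \<in> stem" "y \<in> stem" shows "x \<cdot> y \<in> stem"
proof -
  obtain t where t: "t \<in> J" by (rule J_nonempty)
  have "x \<cdot> y \<cdot> t \<in> J" 
    using stemD(1)[OF assms(1) stemD(1)[OF assms(2) t]] assms[THEN stem_S] J_S[OF t] by (simp add: assoc)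
  then show ?thesis using closed[OF assms[THEN stem_S]] t unfolding stem_def by blast
qed

lemma stem_prime: assumes "x \<in> S" "y \<in> S" "x \<cdot> y \<in> stem" shows "x \<in> stem" "y \<in> stem"
proof -
  obtain t where t: "t \<in> J" by (rule J_nonempty)
  have tS: "t \<in> S" using t J_S by auto
  have "x \<cdot> (y \<cdot> t) \<in> J" "t \<cdot> x \<cdot> y \<in> J" using stemD[OF assms(3) t] assms tS by (simp_all add: assoc)
  then have "y \<cdot> t \<in> J" "t \<cdot> x \<in> J" using J_right_factor[of x "y \<cdot> t"] J_left_factor[of "t \<cdot> x" y] A_mult t assms tS by auto
  then show "x \<in> stem" "y \<in> stem" using assms t unfolding stem_def by blast+
qed

lemma stem_dual: "nonnil_block.stem S (\<lambda>x y. y \<cdot> x) A Z = stem"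
  unfolding nonnil_block.stem_def[OF nonnil_dual] stem_def by blast

section \<open>Neighbours of stem elements and their action on classes\<close>

text \<open>All pairs in \<open>J\<close> with distinct R-classes form a recurrent set with constant
  middle factor w, since pwq stays in the R-class of p. The pair (a, b) enters this set after one
  step, as awb and bwa have the R-classes of aw and b.\<close>

lemma recurrent_if_R_ne:
  assumes a: "a \<in> stem" and b: "b \<in> J" and w: "w \<in> J" and ne: "R (a \<cdot> w) \<noteq> R b"
  shows "\<exists>B. (a, b) \<in> B \<and> recurrent f S Z B"
proof -
  define B where "B = {(p, q). p \<in> J \<and> q \<in> J \<and> R p \<noteq> R q} \<union> {(a, b), (b, a)}"
  have wS: "w \<in> S" using w J_S by auto
  have awJ: "a \<cdot> w \<in> J" "b \<cdot> w \<in> J" using stemD a w b J_mult by auto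
  have aw: "a \<cdot> w \<cdot> b \<in> J" "b \<cdot> w \<cdot> a \<in> J" using awJ J_mult stemD a b by auto
  have R': "R (a \<cdot> w \<cdot> b) = R (a \<cdot> w)" using R_mult[OF awJ(1) J_S[OF b] aw(1)] .
  have R'': "R (b \<cdot> w \<cdot> a) = R b"
    using R_mult[OF awJ(2) stem_S[OF a] aw(2)] R_mult[OF b wS awJ(2)] by simp
  have abne: "a \<noteq> b" using ne R_mult[OF b wS awJ(2)] by auto
  have "recurrent f S Z B" unfolding recurrent_def
  proof (intro conjI allI impI)
    show "sym B" by (auto simp: B_def sym_def)
    fix p q assume pq: "(p, q) \<in> B"
    show "p \<in> S - Z" "q \<in> S - Z" "p \<noteq> q" using pq abne a b stem_S stem_Z J_S by (auto simp: B_def)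
    have "(p \<cdot> w \<cdot> q, q \<cdot> w \<cdot> p) \<in> B"
    proof -
      consider "p \<in> J" "q \<in> J" "R p \<noteq> R q" | "p = a" "q = b" | "p = b" "q = a"
        using pq by (auto simp: B_def)
      then show ?thesis
      proof cases
        case 1
        then have "R (p \<cdot> w \<cdot> q) = R p" "R (q \<cdot> w \<cdot> p) = R q" "p \<cdot> w \<cdot> q \<in> J" "q \<cdot> w \<cdot> p \<in> J"
          using mul3_J J_mult w by auto
        then show ?thesis using 1 by (simp add: B_def)
      next
        case 2 then show ?thesis using aw R' R'' ne by (simp add: B_def)
      next
        case 3 then show ?thesis using aw R' R'' ne by (simp add: B_def)
      qed
    qed
    then show "\<exists>w. opt_in S w \<and> (mul3 f p w q, mul3 f q w p) \<in> B"
      using wS by (intro exI[of _ "Some w"]) (simp add: mul3_def opt_in_def)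
  qed
  then show ?thesis by (intro exI[of _ B]) (simp add: B_def)
qed

lemma recurrent_if_L_ne:
  assumes a: "a \<in> stem" and b: "b \<in> J" and w: "w \<in> J" and ne: "L (w \<cdot> a) \<noteq> L b"
  shows "\<exists>B. (a, b) \<in> B \<and> recurrent f S Z B"
proof -
  have a': "a \<in> nonnil_block.stem S (\<lambda>x y. y \<cdot> x) A Z" using a unfolding stem_dual .
  obtain B where B: "(a, b) \<in> B" "recurrent (\<lambda>x y. y \<cdot> x) S Z B"
    using nonnil_block.recurrent_if_R_ne[OF nonnil_dual a' b w ne] by blast
  have "recurrent f S Z B"
    using recurrent_dual[of S "\<lambda>x y. y \<cdot> x" S Z B, OF sgrp_dual[OF sgrp] subset_refl B(2)] .
  then show ?thesis using B(1) by blast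
qed

text \<open>Of two elements of \<open>J\<close> in different classes, at least one avoids the class
  of ap, or of pa; that one is b.\<close>

lemma stem_neighbour:
  assumes a: "a \<in> stem"
  obtains b B where "b \<in> J" "(a, b) \<in> B" "recurrent f S Z B"
proof -
  obtain p q where pq: "p \<in> J" "q \<in> J" "R p \<noteq> R q \<or> L p \<noteq> L q" using not_all_H_related by blast
  have "\<exists>b\<in>J. R (a \<cdot> p) \<noteq> R b \<or> L (p \<cdot> a) \<noteq> L b" using pq by metis
  then obtain b where b: "b \<in> J" "R (a \<cdot> p) \<noteq> R b \<or> L (p \<cdot> a) \<noteq> L b" by blast
  then have "\<exists>B. (a, b) \<in> B \<and> recurrent f S Z B"
    using recurrent_if_R_ne[OF a b(1) pq(1)] recurrent_if_L_ne[OF a b(1) pq(1)] by blast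
  then show thesis using that b by blast
qed

text \<open>If the action were not constant, some class would differ from that of b and (a, b) would
  be recurrent. But the H-class of b absorbs powers of \<open>a\<close>, and steps avoiding it have
  commuting factors. So the inherited recurrent set lands in one H-class after a single step, which
  is impossible.\<close>

lemma constant_if_fixed:
  assumes a: "a \<in> stem" and b: "b \<in> J" and fixR: "R (a \<cdot> b) = R b" and fixL: "L (b \<cdot> a) = L b"
    and t: "t \<in> J" "t' \<in> J"
  shows "R (a \<cdot> t) = R (a \<cdot> t') \<and> L (t \<cdot> a) = L (t' \<cdot> a)"
proof (rule ccontr)
  assume no: "\<not> ?thesis"
  then consider "R (a \<cdot> t) \<noteq> R b" | "R (a \<cdot> t') \<noteq> R b" | "L (t \<cdot> a) \<noteq> L b" | "L (t' \<cdot> a) \<noteq> L b" by metis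
  then have "\<exists>B. (a, b) \<in> B \<and> recurrent f S Z B"
    by cases (rule recurrent_if_R_ne[OF a b t(1)] recurrent_if_R_ne[OF a b t(2)]
      recurrent_if_L_ne[OF a b t(1)] recurrent_if_L_ne[OF a b t(2)]; assumption)+
  then obtain B where ab: "(a, b) \<in> B" and B: "recurrent f S Z B" by blast
  obtain B' where B': "B' \<noteq> {}" "recurrent f (gen f {a, b}) Z B'" by (rule inheritD[OF ideal_Z B ab])
  have aS: "a \<in> S" and bS: "b \<in> S" using a b stem_S J_S by auto
  define H where "H = {z \<in> J. R z = R b \<and> L z = L b}"
  have aH: "a \<cdot> z \<in> H" "z \<cdot> a \<in> H" if z: "z \<in> H" for z
  proof -
    have zH: "z \<in> J" "R z = R b" "L z = L b" using z by (auto simp: H_def)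
    then have zJ: "z \<in> J" "z \<in> R b" "z \<in> L b"
      using Rs_self[of z S f] Rs_self[of z S "\<lambda>x y. y \<cdot> x"] by simp_all
    have J': "a \<cdot> z \<in> J" "z \<cdot> a \<in> J" "a \<cdot> b \<in> J" "b \<cdot> a \<in> J" using stemD a zJ b by auto
    have "a \<cdot> z \<in> R (a \<cdot> b)" using zJ(2) aS bS by (auto simp: Rs_def assoc)
    then have 1: "R (a \<cdot> z) = R (a \<cdot> b)" by (rule R_eq[OF J'(3,1)])
    have "z \<cdot> a \<in> L (b \<cdot> a)" using zJ(3) aS bS by (auto simp: Rs_def assoc)
    then have 2: "L (z \<cdot> a) = L (b \<cdot> a)" by (rule L_eq[OF J'(4,2)])
    show "a \<cdot> z \<in> H" using 1 J'(1) L_mult[OF zJ(1) aS J'(1)] fixR zH by (simp add: H_def)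
    show "z \<cdot> a \<in> H" using 2 J'(2) R_mult[OF zJ(1) aS J'(2)] fixL zH by (simp add: H_def)
  qed
  have HS: "z \<in> S" if "z \<in> H" for z using that J_S by (auto simp: H_def)
  have HH: "y \<cdot> z \<in> H" if "y \<in> H" "z \<in> H" for y z
    using that J_mult[of y z] R_mult[of y z] L_mult[of z y] J_S by (auto simp: H_def)
  have subS: "gen f {a} \<subseteq> S" using aS by (intro gen_sub) auto
  have gH: "x \<cdot> z \<in> H \<and> z \<cdot> x \<in> H" if "x \<in> gen f {a}" "z \<in> H" for x z
    using that
  proof (induction arbitrary: z)
    case (base x) then show ?case using aH by auto
  next
    case (mult x y)
    have "x \<in> S" "y \<in> S" using mult(1,2) subS by auto
    moreover have "x \<cdot> (y \<cdot> z) \<in> H" "z \<cdot> x \<cdot> y \<in> H" using mult by auto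
    ultimately show ?case using HS[OF mult.prems] by (simp add: assoc)
  qed
  \<comment> \<open>\<open>H\<close> is an ideal of the subsemigroup \<open>M\<close>, and
    \<open>M\<close> contains everything generated by a and b.\<close>
  define M where "M = gen f {a} \<union> H"
  have MH: "x \<cdot> y \<in> H" if "x \<in> M" "y \<in> M" "x \<in> H \<or> y \<in> H" for x y
    using that gH HH by (auto simp: M_def)
  have MM: "x \<cdot> y \<in> M" if "x \<in> M" "y \<in> M" for x y
    using that MH[of x y] gen_closed[of x f "{a}" y] by (auto simp: M_def)
  have genM: "gen f {a, b} \<subseteq> M"
    using MM b by (intro gen_subset) (auto simp: M_def H_def intro: gen.base)
  define C where "C = {(p, q) \<in> B'. p \<in> H \<and> q \<in> H}"
  have next_H: "\<exists>w. opt_in S w \<and> (mul3 f p w q, mul3 f q w p) \<in> C" if pq: "(p, q) \<in> B'" for p q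
  proof -
    note D = recurrentD[OF B'(2) pq]
    have pM: "p \<in> M" "q \<in> M" using D genM by auto
    obtain w where w: "opt_in (gen f {a, b}) w" "(mul3 f p w q, mul3 f q w p) \<in> B'" using D(7) by blast
    have wS: "opt_in S w" using opt_in_mono[OF w(1)] gen_sub[of "{a, b}"] aS bS by auto
    have wM: "opt_in M w" using opt_in_mono[OF w(1) genM] .
    have "p \<in> H \<or> q \<in> H \<or> (\<exists>c. w = Some c \<and> c \<in> H)"
    proof (rule ccontr)
      assume "\<not> ?thesis"
      then have g: "p \<in> gen f {a}" "q \<in> gen f {a}" "opt_in (gen f {a}) w"
        using pM wM by (auto simp: M_def opt_in_def split: option.splits)
      have "mul3 f p w q = mul3 f q w p" using aS by (intro mul3_commute[OF _ _ g]) auto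
      then show False using recurrentD(5)[OF B'(2) w(2)] by blast
    qed
    then have "mul3 f p w q \<in> H \<and> mul3 f q w p \<in> H"
    proof (cases w)
      case None then show ?thesis using MH pM \<open>p \<in> H \<or> _\<close> by (auto simp: mul3_def)
    next
      case (Some c)
      then have c: "c \<in> M" using wM by (simp add: opt_in_def)
      have "p \<cdot> c \<in> M" "q \<cdot> c \<in> M" using MM pM c by auto
      then show ?thesis using MH[of p c] MH[of q c] MH[of "p \<cdot> c" q] MH[of "q \<cdot> c" p]
          pM c \<open>p \<in> H \<or> _\<close> Some by (auto simp: mul3_def)
    qed
    then show ?thesis using w(2) wS by (auto simp: C_def)
  qed
  have "recurrent f S Z C" unfolding recurrent_def
  proof (intro conjI allI impI)
    show "sym C" using recurrentD(6)[OF B'(2)] by (auto simp: C_def sym_def)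
    fix p q assume pq: "(p, q) \<in> C"
    then have pq': "(p, q) \<in> B'" by (simp add: C_def)
    show "p \<in> S - Z" "q \<in> S - Z" "p \<noteq> q"
      using recurrentD[OF B'(2) pq'] pq HS by (auto simp: C_def)
    show "\<exists>w. opt_in S w \<and> (mul3 f p w q, mul3 f q w p) \<in> C" by (rule next_H[OF pq'])
  qed
  then have "C = {}"
    by (rule no_recurrent_in_H_class[OF b b J_mult[OF b b]]) (auto simp: C_def H_def)
  moreover obtain p q where "(p, q) \<in> B'" using B'(1) by auto
  ultimately show False using next_H by blast
qed

text \<open>This makes the indices in \<open>Phi\<close> exist: at stays in one row and ta in one
  column as t varies. The idempotent power is introduced because it visibly fixes some class, which
  is not clear beforehand for \<open>a\<close>.\<close>

lemma stem_classes_constant: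
  assumes a: "a \<in> stem" and t: "t \<in> J" "t' \<in> J"
  shows "R (a \<cdot> t) = R (a \<cdot> t')" "L (t \<cdot> a) = L (t' \<cdot> a)"
proof -
  have aS: "a \<in> S" using a stem_S by auto
  obtain e where e: "e \<in> gen f {a}" "e \<cdot> e = e" by (rule idempotent_power[OF aS])
  have estem: "e \<in> stem" using e(1) gen_subset[of "{a}" stem f] a stem_mult by auto
  have eS: "e \<in> S" using estem stem_S by auto
  have aG: "a \<in> gen f {a}" by (rule gen.base) simp
  have comm: "a \<cdot> e = e \<cdot> a" by (rule gen_commute[OF _ _ aG e(1)]) (use aS in auto)
  have tS: "t \<in> S" using t J_S by auto
  \<comment> \<open>\<open>b\<close> is fixed by \<open>e\<close>, so \<open>e\<close> acts constantly on classes; as \<open>a\<close> commutes with \<open>e\<close>,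
    it fixes the classes of \<open>b\<close> as well.\<close>
  define b where "b = e \<cdot> t \<cdot> e"
  have bJ: "b \<in> J" unfolding b_def by (rule stemD(2)[OF estem stemD(1)[OF estem t(1)]])
  have eb: "e \<cdot> b = b" unfolding b_def using e(2) eS tS assoc by (metis closed)
  have be: "b \<cdot> e = b" unfolding b_def using e(2) eS tS assoc by (metis closed)
  have const: "R (e \<cdot> x) = R (e \<cdot> y) \<and> L (x \<cdot> e) = L (y \<cdot> e)" if "x \<in> J" "y \<in> J" for x y
    by (rule constant_if_fixed[OF estem bJ _ _ that]) (simp_all add: eb be)
  have J': "a \<cdot> (t \<cdot> e) \<in> J" "t \<cdot> e \<in> J" "e \<cdot> t \<cdot> a \<in> J" "e \<cdot> t \<in> J"
    using stemD[OF estem t(1)] stemD(1)[OF a] stemD(2)[OF a] by auto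
  have "a \<cdot> b = a \<cdot> e \<cdot> (t \<cdot> e)" unfolding b_def using aS eS tS by (simp add: assoc)
  also have "\<dots> = e \<cdot> (a \<cdot> (t \<cdot> e))" using aS eS tS by (simp add: comm assoc)
  finally have ab: "a \<cdot> b = e \<cdot> (a \<cdot> (t \<cdot> e))" .
  have "b \<cdot> a = e \<cdot> t \<cdot> (e \<cdot> a)" unfolding b_def using aS eS tS by (simp add: assoc)
  also have "\<dots> = e \<cdot> t \<cdot> a \<cdot> e" using aS eS tS by (simp add: comm[symmetric] assoc)
  finally have ba: "b \<cdot> a = e \<cdot> t \<cdot> a \<cdot> e" .
  have b': "b = e \<cdot> (t \<cdot> e)" unfolding b_def using eS tS by (simp add: assoc)
  have "R (a \<cdot> b) = R b" unfolding ab using const[OF J'(1,2)] b' by simp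
  moreover have "L (b \<cdot> a) = L b" unfolding ba using const[OF J'(3,4)] b_def by simp
  ultimately have "R (a \<cdot> t) = R (a \<cdot> t') \<and> L (t \<cdot> a) = L (t' \<cdot> a)"
    by (rule constant_if_fixed[OF a bJ _ _ t])
  then show "R (a \<cdot> t) = R (a \<cdot> t')" "L (t \<cdot> a) = L (t' \<cdot> a)" by auto
qed

end

section \<open>The principal series\<close>

locale pn_series = pn_semigroup +
  fixes Ss :: "nat \<Rightarrow> 'a set" and m :: nat
  assumes series: "principal_series S f Ss m"
begin

lemma ideal_Ss: "i \<in> {1..Suc m} \<Longrightarrow> ideal S f (Ss i)"
  using series by (simp add: principal_series_def)

lemma Ss_S: "i \<in> {1..Suc m} \<Longrightarrow> Ss i \<subseteq> S"
  using ideal_Ss by (simp add: ideal_def)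

lemma Ss_Suc: "i \<in> {1..m} \<Longrightarrow> Ss (Suc i) \<subset> Ss i"
  using series by (simp add: principal_series_def)

lemma Ss_antimono:
  assumes "1 \<le> i" "i \<le> j" "j \<le> Suc m" shows "Ss j \<subseteq> Ss i"
  using assms(2,3)
proof (induction j rule: dec_induct)
  case (step n) then show ?case using Ss_Suc[of n] assms(1) by auto
qed simp

lemma blk_S: "i \<in> {1..m} \<Longrightarrow> x \<in> blk Ss i \<Longrightarrow> x \<in> S"
  using Ss_S[of i] by (auto simp: blk_def)

lemma blk_nonempty: "i \<in> {1..m} \<Longrightarrow> blk Ss i \<noteq> {}"
  using Ss_Suc[of i] by (auto simp: blk_def)

lemma in_Ss_iff:
  assumes "i \<in> {1..m}" "j \<in> {1..Suc m}" "x \<in> blk Ss i" shows "x \<in> Ss j \<longleftrightarrow> j \<le> i"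
proof
  show "x \<in> Ss j \<Longrightarrow> j \<le> i"
    using Ss_antimono[of "Suc i" j] assms by (force simp: blk_def)
  show "j \<le> i \<Longrightarrow> x \<in> Ss j"
    using Ss_antimono[of j i] assms by (auto simp: blk_def)
qed

lemma blk_inj: "i \<in> {1..m} \<Longrightarrow> j \<in> {1..m} \<Longrightarrow> x \<in> blk Ss i \<Longrightarrow> x \<in> blk Ss j \<Longrightarrow> i = j"
  using in_Ss_iff[of i j x] in_Ss_iff[of j i x] by (auto simp: blk_def)

lemma blk_cover:
  assumes "x \<in> S" obtains i where "i \<in> {1..m}" "x \<in> blk Ss i"
proof -
  define i where "i = Max {i \<in> {1..Suc m}. x \<in> Ss i}"
  have "Ss 1 = S" "Ss (Suc m) = {}" using series by (auto simp: principal_series_def)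
  then have ne: "1 \<in> {i \<in> {1..Suc m}. x \<in> Ss i}" using assms by simp
  then have "i \<in> {i \<in> {1..Suc m}. x \<in> Ss i}" unfolding i_def by (intro Max_in) auto
  then have i: "i \<in> {1..m}" "x \<in> Ss i" using \<open>Ss (Suc m) = {}\<close> by (auto simp: le_Suc_eq)
  have "x \<notin> Ss (Suc i)"
  proof
    assume "x \<in> Ss (Suc i)"
    then have "Suc i \<le> i" using i unfolding i_def by (intro Max_ge) auto
    then show False by simp
  qed
  then show thesis using that i by (auto simp: blk_def)
qed

lemma block:
  assumes i: "i \<in> {1..m}" shows "pn_block S f (Ss i) (Ss (Suc i))"
proof unfold_locales
  show "ideal S f (Ss i)" "ideal S f (Ss (Suc i))" using ideal_Ss i by auto
  show "Ss (Suc i) \<subseteq> Ss i" using Ss_Suc[OF i] by auto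
  fix a b assume a: "a \<in> Ss i - Ss (Suc i)" and b: "b \<in> Ss i - Ss (Suc i)"
  have aS: "a \<in> S" using a Ss_S[of i] i by auto
  \<comment> \<open>The ideal \<open>S^1 a S^1\<close>. Intersected with \<open>Ss i\<close> and
    joined to \<open>Ss (Suc i)\<close> it lies between neighbouring terms; as it contains
    \<open>a\<close>, minimality makes it all of \<open>Ss i\<close>.\<close>
  define M where "M = (\<Union>c\<in>Ls S f a. Rs S f c)"
  have LS: "c \<in> S" if "c \<in> Ls S f a" for c using that aS by (auto simp: Rs_def)
  have "ideal S f M" unfolding ideal_def
  proof (intro conjI ballI)
    show "M \<subseteq> S" using LS Rs_sub unfolding M_def by blast
    fix x s assume x: "x \<in> M" and s: "s \<in> S"
    then obtain c where c: "c \<in> Ls S f a" "x \<in> Rs S f c" by (auto simp: M_def)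
    have "s \<cdot> c \<in> Ls S f a" using c(1) s aS by (auto simp: Rs_def assoc[symmetric])
    moreover have "s \<cdot> x \<in> Rs S f (s \<cdot> c)" using c(2) s LS[OF c(1)] by (auto simp: Rs_def assoc)
    ultimately show "s \<cdot> x \<in> M" unfolding M_def by (rule UN_I)
    have "x \<cdot> s \<in> Rs S f c" using c(2) s LS[OF c(1)] by (auto simp: Rs_def assoc)
    with c(1) show "x \<cdot> s \<in> M" unfolding M_def by (rule UN_I)
  qed
  then have id: "ideal S f (Ss (Suc i) \<union> (M \<inter> Ss i))"
    using ideal_Ss[of i] ideal_Ss[of "Suc i"] i by (auto simp: ideal_def)
  have "Ss (Suc i) \<union> (M \<inter> Ss i) \<subseteq> Ss i" using Ss_Suc[OF i] by auto
  then have "Ss (Suc i) \<union> (M \<inter> Ss i) = Ss (Suc i) \<or> Ss (Suc i) \<union> (M \<inter> Ss i) = Ss i"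
    using series id i unfolding principal_series_def by (metis Un_upper1)
  moreover have "a \<in> M" unfolding M_def by (rule UN_I[of a]) simp_all
  ultimately have "b \<in> M" using a b by blast
  then show "\<exists>c\<in>Ls S f a. b \<in> Rs S f c" by (simp add: M_def)
qed

lemma factor_nilp_iff:
  assumes i: "i \<in> {1..m}"
  shows "factor_nilp f Ss i \<longleftrightarrow> \<not> (\<exists>B. B \<noteq> {} \<and> recurrent f (Ss i) (Ss (Suc i)) B)"
  unfolding factor_nilp_def
proof (rule rees_nilpotent_iff)
  have sub: "Ss i \<subseteq> S" using Ss_S i by auto
  then show "finite (Ss i)" using finite_S finite_subset by blast
  show "x \<cdot> y \<in> Ss i" if "x \<in> Ss i" "y \<in> Ss i" for x y
    using that ideal_Ss[of i] i sub by (auto simp: ideal_def)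
  show "ideal (Ss i) f (Ss (Suc i))" using ideal_Ss[of "Suc i"] i sub Ss_Suc[OF i] by (auto simp: ideal_def)
qed

section \<open>Stems along the series\<close>

definition nonnil :: "nat set" where
  "nonnil = {i \<in> {1..m}. \<not> factor_nilp f Ss i}"

lemma nonnil_I: "i \<in> nonnil \<Longrightarrow> i \<in> {1..m}"
  by (simp add: nonnil_def)

lemma nonnil_block: assumes i: "i \<in> nonnil" shows "nonnil_block S f (Ss i) (Ss (Suc i))"
  using block[of i] factor_nilp_iff[of i] i
  by (simp add: nonnil_block_def nonnil_block_axioms_def nonnil_def)

abbreviation star :: "nat \<Rightarrow> 'a set" where "star \<equiv> Sstar S f Ss"

lemma star_eq_stem:
  assumes i: "i \<in> nonnil" shows "star i = nonnil_block.stem S f (Ss i) (Ss (Suc i))"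
proof -
  interpret nonnil_block S f "Ss i" "Ss (Suc i)" by (rule nonnil_block[OF i])
  have "s \<in> star i \<longleftrightarrow> s \<in> stem" for s
  proof (cases "s \<in> J")
    case True then show ?thesis using J_stem by (auto simp: Sstar_def blk_def)
  next
    case False
    have "s \<in> star i \<longleftrightarrow> s \<in> S \<and> s \<notin> Ss i \<and> (\<exists>t\<in>J. s \<cdot> t \<notin> Ss (Suc i) \<or> t \<cdot> s \<notin> Ss (Suc i))"
      using False by (auto simp: Sstar_def FF_def blk_def)
    also have "\<dots> \<longleftrightarrow> s \<in> S \<and> s \<notin> Ss i \<and> (\<exists>t\<in>J. s \<cdot> t \<in> J \<or> t \<cdot> s \<in> J)"
      using A_mult by blast
    also have "\<dots> \<longleftrightarrow> s \<in> stem" using False stem_Z unfolding stem_def by blast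
    finally show ?thesis .
  qed
  then show ?thesis by blast
qed

lemma star_S: "i \<in> {1..m} \<Longrightarrow> x \<in> star i \<Longrightarrow> x \<in> S"
  using blk_S by (auto simp: Sstar_def FF_def)

lemma blk_star: "blk Ss i \<subseteq> star i"
  by (simp add: Sstar_def)

lemma star_mult: "i \<in> nonnil \<Longrightarrow> x \<in> star i \<Longrightarrow> y \<in> star i \<Longrightarrow> x \<cdot> y \<in> star i"
  using nonnil_block.stem_mult[OF nonnil_block] star_eq_stem by simp

lemma star_prime:
  assumes "i \<in> nonnil" "x \<in> S" "y \<in> S" "x \<cdot> y \<in> star i" shows "x \<in> star i" "y \<in> star i"
  using nonnil_block.stem_prime[OF nonnil_block[OF assms(1)] assms(2,3)] assms(4) star_eq_stem[OF assms(1)] by auto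

lemma star_not_Suc: "i \<in> {1..m} \<Longrightarrow> x \<in> star i \<Longrightarrow> x \<notin> Ss (Suc i)"
  using Ss_Suc[of i] by (auto simp: Sstar_def FF_def blk_def)

text \<open>Elements of a block are multiples of each other, and every factor of a stem element is
  in the stem by primeness. So a stem contains a block as soon as it meets it.\<close>

lemma blk_sub_star:
  assumes i: "i \<in> nonnil" and k: "k \<in> {1..m}" and x: "x \<in> blk Ss k" "x \<in> star i"
  shows "blk Ss k \<subseteq> star i"
proof
  fix y assume y: "y \<in> blk Ss k"
  have yS: "y \<in> S" using blk_S k y by auto
  obtain c where c: "c \<in> Ls S f y" "x \<in> Rs S f c"
    using pn_block.same_ideal[OF block[OF k], of y x] x y by (auto simp: blk_def)
  have cS: "c \<in> S" using c(1) yS by (auto simp: Rs_def)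
  have "c \<in> star i" using c(2) x(2) star_prime[OF i cS] by (auto simp: Rs_def)
  then show "y \<in> star i" using c(1) star_prime[OF i _ yS] by (auto simp: Rs_def)
qed

lemma blk_star_le:
  assumes "i \<in> {1..m}" "k \<in> {1..m}" "blk Ss k \<subseteq> star i" shows "k \<le> i"
proof -
  obtain x where x: "x \<in> blk Ss k" using blk_nonempty assms by blast
  have "x \<notin> Ss (Suc i)" using x assms star_not_Suc by blast
  then show ?thesis using in_Ss_iff[of k "Suc i" x] assms x by auto
qed

lemma blk_star_FF:
  assumes "i \<in> {1..m}" "k \<in> {1..m}" "blk Ss k \<subseteq> star i" "k \<noteq> i" shows "blk Ss k \<subseteq> FF S f Ss i"
  using assms blk_inj unfolding Sstar_def by blast

section \<open>Edges of the graph and stems\<close>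

lemma nn_edge_iff:
  assumes "a \<in> S" "b \<in> S"
  shows "nn_edge f a b \<longleftrightarrow> (\<exists>B. B \<noteq> {} \<and> recurrent f (gen f {a, b}) {} B)"
proof -
  have "finite (gen f {a, b})" using gen_sub[of "{a, b}"] assms finite_S finite_subset by auto
  then show ?thesis unfolding nn_edge_def 
    using nilpotent_iff_no_recurrent[of "gen f {a, b}" f] gen_closed[of _ f "{a, b}"] by blast
qed

lemma star_neighbour:
  assumes i: "i \<in> nonnil" and a: "a \<in> star i"
  obtains b where "b \<in> blk Ss i" "a \<noteq> b" "nn_edge f a b"
proof -
  have a': "a \<in> nonnil_block.stem S f (Ss i) (Ss (Suc i))" using a star_eq_stem[OF i] by simp
  obtain b B where b: "b \<in> Ss i - Ss (Suc i)" "(a, b) \<in> B" "recurrent f S (Ss (Suc i)) B"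
    by (rule nonnil_block.stem_neighbour[OF nonnil_block[OF i] a'])
  have rec: "recurrent f S {} B" using b(3) by (simp add: recurrent_def)
  have id: "ideal S f {}" by (simp add: ideal_def)
  obtain B' where B': "B' \<noteq> {}" "recurrent f (gen f {a, b}) {} B'" by (rule inheritD[OF id rec b(2)])
  note D = recurrentD[OF rec b(2)]
  have "nn_edge f a b" using nn_edge_iff[OF D(1,2)] B' by blast
  then show thesis using that[of b] b(1) D(5) by (simp add: blk_def)
qed

text \<open>The products forming a recurrent set move down the series, so its pairs lying deepest
  form a recurrent set inside a single block.\<close>
lemma recurrent_in_block:
  assumes T: "T \<subseteq> S" and B: "recurrent f T {} B" and ne: "B \<noteq> {}"
  obtains j B' where "j \<in> nonnil" "B' \<noteq> {}" "recurrent f T (Ss (Suc j)) B'"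
    "\<And>p q. (p, q) \<in> B' \<Longrightarrow> p \<in> blk Ss j \<and> q \<in> blk Ss j"
proof -
  define X where "X = {i \<in> {1..m}. \<exists>p q. (p, q) \<in> B \<and> p \<in> blk Ss i}"
  have inS: "p \<in> S \<and> q \<in> S" if "(p, q) \<in> B" for p q using recurrentD(1,2)[OF B that] T by auto
  obtain p0 q0 where "(p0, q0) \<in> B" using ne by auto
  moreover obtain i0 where "i0 \<in> {1..m}" "p0 \<in> blk Ss i0"
    using blk_cover[of p0] inS[OF \<open>(p0, q0) \<in> B\<close>] by blast
  ultimately have "i0 \<in> X" by (auto simp: X_def)
  define j where "j = Max X"
  have finX: "finite X" by (simp add: X_def)
  have "j \<in> X" unfolding j_def using finX \<open>i0 \<in> X\<close> by (intro Max_in) auto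
  then obtain p q where j: "j \<in> {1..m}" and pq: "(p, q) \<in> B" "p \<in> blk Ss j" by (auto simp: X_def)
  have jS: "j \<in> {1..Suc m}" "Suc j \<in> {1..Suc m}" using j by auto
  have deep: "x \<notin> Ss (Suc j)" if xy: "(x, y) \<in> B" for x y
  proof
    assume x: "x \<in> Ss (Suc j)"
    obtain i where i: "i \<in> {1..m}" "x \<in> blk Ss i" using blk_cover[of x] inS[OF xy] by blast
    then have "i \<in> X" using xy by (auto simp: X_def)
    then have "i \<le> j" unfolding j_def using finX by simp
    then show False using in_Ss_iff[OF i(1) jS(2) i(2)] x by simp
  qed
  have idj: "ideal S f (Ss j)" using ideal_Ss jS by auto
  define B' where "B' = {(x, y) \<in> B. x \<in> Ss j \<and> y \<in> Ss j}"
  have nxt: "\<exists>w. opt_in T w \<and> (mul3 f x w y, mul3 f y w x) \<in> B'" if xy: "(x, y) \<in> B" "x \<in> Ss j" for x y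
  proof -
    obtain w where w: "opt_in T w" "(mul3 f x w y, mul3 f y w x) \<in> B" using recurrentD(7)[OF B xy(1)] by blast
    have "mul3 f x w y \<in> Ss j \<and> mul3 f y w x \<in> Ss j"
      using idj xy(2) inS[OF xy(1)] opt_in_mono[OF w(1) T]
      by (cases w) (auto simp: mul3_def opt_in_def ideal_def)
    then show ?thesis using w by (auto simp: B'_def)
  qed
  have rec: "recurrent f T (Ss (Suc j)) B'" unfolding recurrent_def
  proof (intro conjI allI impI)
    show "sym B'" using recurrentD(6)[OF B] by (auto simp: B'_def sym_def)
    fix x y assume "(x, y) \<in> B'"
    then have xy: "(x, y) \<in> B" "x \<in> Ss j" by (auto simp: B'_def)
    note D = recurrentD[OF B xy(1)]
    show "x \<in> T - Ss (Suc j)" "y \<in> T - Ss (Suc j)" "x \<noteq> y" using D deep[OF xy(1)] deep[OF D(6)] by auto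
    show "\<exists>w. opt_in T w \<and> (mul3 f x w y, mul3 f y w x) \<in> B'" by (rule nxt[OF xy])
  qed
  have blk: "x \<in> blk Ss j \<and> y \<in> blk Ss j" if "(x, y) \<in> B'" for x y
    using that recurrentD(3,4)[OF rec that] by (auto simp: B'_def blk_def)
  have pj: "p \<in> Ss j" using pq by (simp add: blk_def)
  obtain x y where xy: "(x, y) \<in> B'" using nxt[OF pq(1) pj] by blast
  then have ne': "B' \<noteq> {}" by auto
  \<comment> \<open>The middle factors for \<open>B'\<close> may lie outside \<open>Ss j\<close>, so
    \<open>B'\<close> says nothing yet about the factor. Inheritance moves to the subsemigroup
    generated by one pair, which is inside \<open>Ss j\<close>.\<close>
  obtain C where C: "C \<noteq> {}" "recurrent f (gen f {x, y}) (Ss (Suc j)) C"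
    by (rule inheritD[OF ideal_Ss[OF jS(2)] recurrent_mono[OF rec T] xy])
  have "gen f {x, y} \<subseteq> Ss j"
    by (rule gen_subset) (use xy idj in \<open>auto simp: B'_def ideal_def\<close>)
  then have "\<not> factor_nilp f Ss j" using factor_nilp_iff[OF j] recurrent_mono[OF C(2)] C(1) by blast
  then have "j \<in> nonnil" using j by (simp add: nonnil_def)
  then show thesis using that[OF _ ne' rec blk] by blast
qed

text \<open>The products of a step lie in the stem, so by primeness p, q and the middle factor do
  too. A word in a and b that lies in the stem cannot contain b, hence all factors are powers of
  \<open>a\<close> and commute.\<close>

lemma no_recurrent_outside_star:
  assumes ab: "a \<in> S" "b \<in> S" and j: "j \<in> nonnil" and b: "b \<notin> star j"
    and B: "recurrent f (gen f {a, b}) Z B"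
    and blk: "\<And>p q. (p, q) \<in> B \<Longrightarrow> p \<in> blk Ss j \<and> q \<in> blk Ss j"
  shows "B = {}"
proof (rule ccontr)
  assume "B \<noteq> {}"
  then obtain p q where pq: "(p, q) \<in> B" by auto
  note D = recurrentD[OF B pq]
  have sub: "gen f {a, b} \<subseteq> S" using ab by (intro gen_sub) auto
  have ga: "x \<in> gen f {a}" if "x \<in> gen f {a, b}" "x \<in> star j" for x
    using that
  proof induction
    case (base x) then show ?case using b by (auto intro: gen.base)
  next
    case (mult x y)
    have "x \<in> S" "y \<in> S" using mult(1,2) sub by auto
    then have "x \<in> star j" "y \<in> star j" using star_prime[OF j _ _ mult.prems] by auto
    then show ?case using mult.IH by (intro gen_closed) auto
  qed
  obtain w where w: "opt_in (gen f {a, b}) w" "(mul3 f p w q, mul3 f q w p) \<in> B" using D(7) by blast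
  have S': "p \<in> S" "q \<in> S" using D(1,2) sub by auto
  have st: "p \<in> star j" "q \<in> star j" "mul3 f p w q \<in> star j"
    using blk[OF pq] blk[OF w(2)] blk_star by auto
  have wa: "opt_in (gen f {a}) w"
  proof (cases w)
    case (Some c)
    then have c: "c \<in> gen f {a, b}" using w(1) by (simp add: opt_in_def)
    have cS: "c \<in> S" using c sub by auto
    have "p \<cdot> c \<cdot> q \<in> star j" using st(3) Some by (simp add: mul3_def)
    then have "p \<cdot> c \<in> star j" by (rule star_prime(1)[OF j closed[OF S'(1) cS] S'(2)])
    then have "c \<in> star j" by (rule star_prime(2)[OF j S'(1) cS])
    then show ?thesis using ga[OF c] Some by (simp add: opt_in_def)
  qed (simp add: opt_in_def)
  have "mul3 f p w q = mul3 f q w p"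
    by (rule mul3_commute[OF _ _ ga[OF D(1) st(1)] ga[OF D(2) st(2)] wa]) (use ab in auto)
  then show False using recurrentD(5)[OF B w(2)] by blast
qed

lemma edge_imp_star:
  assumes ab: "a \<in> S" "b \<in> S" and e: "nn_edge f a b"
  obtains j where "j \<in> nonnil" "a \<in> star j" "b \<in> star j"
proof -
  obtain B where B: "B \<noteq> {}" "recurrent f (gen f {a, b}) {} B" using nn_edge_iff[OF ab] e by blast
  have sub: "gen f {a, b} \<subseteq> S" using ab by (intro gen_sub) auto
  obtain j B' where j: "j \<in> nonnil" and B': "B' \<noteq> {}" "recurrent f (gen f {a, b}) (Ss (Suc j)) B'"
    and blk: "\<And>p q. (p, q) \<in> B' \<Longrightarrow> p \<in> blk Ss j \<and> q \<in> blk Ss j"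
    by (rule recurrent_in_block[OF sub B(2,1)]) blast
  have "b \<in> star j" using no_recurrent_outside_star[OF ab j _ B'(2) blk] B'(1) by blast
  moreover have "a \<in> star j"
  proof (rule ccontr)
    assume a: "a \<notin> star j"
    have "B' = {}"
      by (rule no_recurrent_outside_star[OF ab(2,1) j a _ blk]) (use B'(2) in \<open>simp_all add: insert_commute\<close>)
    then show False using B'(1) by simp
  qed
  ultimately show thesis using that j by blast
qed

section \<open>Roots, isolated subsets and the ideal K\<close>

text \<open>If a later stem contains the block, \<open>star_neighbour\<close> finds an adjacent b
  deep enough to lie in \<open>Ss (Suc i)\<close>. Conversely an edge from the block to such a b
  puts both ends in one stem, and since \<open>star j\<close> avoids \<open>Ss (Suc j)\<close>, this
  forces i < j.\<close>

lemma root_iff: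
  assumes i: "i \<in> {1..m}"
  shows "is_root f Ss i \<longleftrightarrow> i \<in> nonnil \<and> (\<forall>j\<in>nonnil. i < j \<longrightarrow> \<not> blk Ss i \<subseteq> star j)"
proof (intro iffI conjI ballI impI)
  assume r: "is_root f Ss i"
  then show "i \<in> nonnil" using i by (simp add: is_root_def nonnil_def)
  fix j assume j: "j \<in> nonnil" "i < j"
  show "\<not> blk Ss i \<subseteq> star j"
  proof
    assume sub: "blk Ss i \<subseteq> star j"
    obtain a where a: "a \<in> blk Ss i" using blk_nonempty[OF i] by auto
    then have "a \<in> star j" using sub by auto
    then obtain b where b: "b \<in> blk Ss j" "a \<noteq> b" "nn_edge f a b" by (rule star_neighbour[OF j(1)])
    have "b \<in> Ss (Suc i)" using in_Ss_iff[OF nonnil_I[OF j(1)] _ b(1), of "Suc i"] j(2) i by auto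
    then show False using r a b(3) by (auto simp: is_root_def nn_edge_def)
  qed
next
  assume *: "i \<in> nonnil \<and> (\<forall>j\<in>nonnil. i < j \<longrightarrow> \<not> blk Ss i \<subseteq> star j)"
  show "is_root f Ss i" unfolding is_root_def
  proof (intro conjI ballI)
    show "\<not> factor_nilp f Ss i" using * by (simp add: nonnil_def)
    fix a b assume a: "a \<in> blk Ss i" and b: "b \<in> Ss (Suc i)"
    show "nilpotent (gen f {a, b}) f"
    proof (rule ccontr)
      assume "\<not> nilpotent (gen f {a, b}) f"
      then have e: "nn_edge f a b" by (simp add: nn_edge_def)
      have S': "a \<in> S" "b \<in> S" using blk_S[OF i a] b Ss_S[of "Suc i"] i by auto
      obtain j where j: "j \<in> nonnil" "a \<in> star j" "b \<in> star j" by (rule edge_imp_star[OF S' e])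
      have "i < j"
      proof (rule ccontr)
        assume "\<not> i < j"
        then have "Ss (Suc i) \<subseteq> Ss (Suc j)" using Ss_antimono[of "Suc j" "Suc i"] i by auto
        then show False using star_not_Suc[OF nonnil_I[OF j(1)] j(3)] b by auto
      qed
      then show False using * j(1) blk_sub_star[OF j(1) i a j(2)] by blast
    qed
  qed
qed

text \<open>A non-nilpotent block that is not a root lies in a later non-nilpotent stem, which the
  second clause of the definition forbids. So isolated blocks have nilpotent factors, and their own
  stem does not interfere.\<close>

lemma isolated_iff:
  assumes i: "i \<in> {1..m}"
  shows "is_isolated S f Ss m i \<longleftrightarrow> (\<forall>j\<in>nonnil. \<not> blk Ss i \<subseteq> star j)"
proof
  assume iso: "is_isolated S f Ss m i"
  have far: "\<not> blk Ss i \<subseteq> star j" if j: "j \<in> nonnil" "j \<noteq> i" for j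
    using iso blk_star_FF[OF nonnil_I[OF j(1)] i] j unfolding is_isolated_def nonnil_def by blast
  have "i \<notin> nonnil"
  proof
    assume "i \<in> nonnil"
    then obtain j where "j \<in> nonnil" "i < j" "blk Ss i \<subseteq> star j"
      using iso root_iff[OF i] unfolding is_isolated_def by blast
    then show False using far by blast
  qed
  then show "\<forall>j\<in>nonnil. \<not> blk Ss i \<subseteq> star j" using far by blast
next
  assume none: "\<forall>j\<in>nonnil. \<not> blk Ss i \<subseteq> star j"
  then have "i \<notin> nonnil" using blk_star by blast
  then show "is_isolated S f Ss m i"
    using none root_iff[OF i] unfolding is_isolated_def nonnil_def Sstar_def by blast
qed

abbreviation K :: "'a set" where "K \<equiv> Kset S f Ss m"

lemma K_eq: "K = {x \<in> S. \<forall>j\<in>nonnil. x \<notin> star j}"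
proof (intro equalityI subsetI)
  fix x assume "x \<in> K"
  then obtain i where i: "i \<in> {1..m}" "is_isolated S f Ss m i" "x \<in> blk Ss i" by (auto simp: Kset_def)
  then show "x \<in> {x \<in> S. \<forall>j\<in>nonnil. x \<notin> star j}"
    using blk_S[OF i(1,3)] isolated_iff[OF i(1)] blk_sub_star[OF _ i(1,3)] by blast
next
  fix x assume x: "x \<in> {x \<in> S. \<forall>j\<in>nonnil. x \<notin> star j}"
  then obtain i where i: "i \<in> {1..m}" "x \<in> blk Ss i" using blk_cover by blast
  then have "is_isolated S f Ss m i" using isolated_iff x by blast
  then show "x \<in> K" using i unfolding Kset_def by blast
qed

lemma star_transitive:
  assumes i: "i1 \<in> {1..m}" "i2 \<in> {1..m}" "i3 \<in> {1..m}"
    and sub: "blk Ss i1 \<subseteq> star i2" "blk Ss i2 \<subseteq> star i3"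
  shows "blk Ss i1 \<subseteq> star i3"
proof (cases "i1 = i2 \<or> i2 = i3")
  case True then show ?thesis using sub by auto
next
  case ne: False
  show ?thesis
  proof
    fix a assume a: "a \<in> blk Ss i1"
    have "a \<in> FF S f Ss i2" using blk_star_FF[OF i(2,1) sub(1)] ne a by auto
    then obtain t where t: "t \<in> blk Ss i2" "a \<cdot> t \<notin> Ss (Suc i2) \<or> t \<cdot> a \<notin> Ss (Suc i2)"
      by (auto simp: FF_def)
    have S': "a \<in> S" "t \<in> S" using blk_S i a t by auto
    have id: "ideal S f (Ss i2)" "ideal S f (Ss i3)" "ideal S f (Ss (Suc i3))" using ideal_Ss i by auto
    have "a \<cdot> t \<in> blk Ss i2 \<or> t \<cdot> a \<in> blk Ss i2" using t id S' by (auto simp: blk_def ideal_def)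
    then obtain x where x: "x \<in> blk Ss i2" "x = a \<cdot> t \<or> x = t \<cdot> a" by blast
    have "x \<in> FF S f Ss i3" using blk_star_FF[OF i(3,2) sub(2)] ne x by auto
    then obtain u where u: "u \<in> blk Ss i3" "x \<cdot> u \<notin> Ss (Suc i3) \<or> u \<cdot> x \<notin> Ss (Suc i3)"
      by (auto simp: FF_def)
    have uS: "u \<in> S" using blk_S i u by auto
    have key: "\<exists>v\<in>blk Ss i3. a \<cdot> v \<notin> Ss (Suc i3) \<or> v \<cdot> a \<notin> Ss (Suc i3)"
    proof -
      have Z: "y \<cdot> s \<notin> Ss (Suc i3) \<Longrightarrow> y \<notin> Ss (Suc i3)" "s \<cdot> y \<notin> Ss (Suc i3) \<Longrightarrow> y \<notin> Ss (Suc i3)"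
        if "s \<in> S" for y s
        using id(3) that by (auto simp: ideal_def)
      have A: "s \<cdot> u \<in> Ss i3" "u \<cdot> s \<in> Ss i3" if "s \<in> S" for s
        using id(2) that u(1) by (auto simp: ideal_def blk_def)
      \<comment> \<open>In the first and last case t is absorbed into the witness, tu or ut; in the
        other two it is dropped and u itself works.\<close>
      consider "a \<cdot> (t \<cdot> u) \<notin> Ss (Suc i3)" | "u \<cdot> a \<cdot> t \<notin> Ss (Suc i3)" | "t \<cdot> (a \<cdot> u) \<notin> Ss (Suc i3)"
        | "u \<cdot> t \<cdot> a \<notin> Ss (Suc i3)" using x(2) u(2) S' uS by (auto simp: assoc)
      then show ?thesis
      proof cases
        case 1 then show ?thesis using Z(2)[OF S'(1), of "t \<cdot> u"] A[OF S'(2)] unfolding blk_def by blast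
      next
        case 2 then show ?thesis using Z(1)[OF S'(2), of "u \<cdot> a"] u(1) by blast
      next
        case 3 then show ?thesis using Z(2)[OF S'(2), of "a \<cdot> u"] u(1) by blast
      next
        case 4 then show ?thesis using Z(1)[OF S'(1), of "u \<cdot> t"] A[OF S'(2)] unfolding blk_def by blast
      qed
    qed
    \<comment> \<open>\<open>FF\<close> only admits elements outside \<open>Ss i3\<close>, which
      strict order of the blocks guarantees.\<close>
    have "i1 < i3" using blk_star_le[OF i(2,1) sub(1)] blk_star_le[OF i(3,2) sub(2)] ne by auto
    then have "a \<notin> Ss i3" using in_Ss_iff[OF i(1) _ a, of i3] i(3) by auto
    then show "a \<in> star i3" using key S' by (auto simp: Sstar_def FF_def)
  qed
qed

text \<open>Take the largest non-nilpotent index from j on whose stem contains the block; by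
  transitivity a later stem containing that root candidate would contradict maximality.\<close>

lemma star_in_root_star:
  assumes i: "i \<in> {1..m}" and j: "j \<in> nonnil" "blk Ss i \<subseteq> star j"
  obtains k where "k \<in> {1..m}" "is_root f Ss k" "j \<le> k" "blk Ss i \<subseteq> star k"
proof -
  define X where "X = {k \<in> nonnil. j \<le> k \<and> blk Ss i \<subseteq> star k}"
  have X: "finite X" "j \<in> X" using j by (auto simp: X_def nonnil_def)
  define k where "k = Max X"
  have "k \<in> X" unfolding k_def using X by (intro Max_in) auto
  then have k: "k \<in> nonnil" "j \<le> k" "blk Ss i \<subseteq> star k" by (auto simp: X_def)
  have "\<not> blk Ss k \<subseteq> star l" if l: "l \<in> nonnil" "k < l" for l
  proof
    assume "blk Ss k \<subseteq> star l"
    then have "l \<in> X" using star_transitive[OF i nonnil_I[OF k(1)] nonnil_I[OF l(1)] k(3)] l k by (auto simp: X_def)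
    then have "l \<le> k" unfolding k_def using X(1) by simp
    then show False using l by simp
  qed
  then have "is_root f Ss k" using root_iff[OF nonnil_I[OF k(1)]] k(1) by blast
  then show thesis using that[OF nonnil_I[OF k(1)]] k by blast
qed

lemma K_complement: "S - K = \<Union> {star j | j. j \<in> {1..m} \<and> is_root f Ss j}"
proof (intro equalityI subsetI)
  fix x assume "x \<in> S - K"
  then obtain j where j: "j \<in> nonnil" "x \<in> star j" and x: "x \<in> S" unfolding K_eq by blast
  obtain i where i: "i \<in> {1..m}" "x \<in> blk Ss i" by (rule blk_cover[OF x])
  obtain k where "k \<in> {1..m}" "is_root f Ss k" "j \<le> k" "blk Ss i \<subseteq> star k"
    by (rule star_in_root_star[OF i(1) j(1) blk_sub_star[OF j(1) i j(2)]])
  then show "x \<in> \<Union> {star j | j. j \<in> {1..m} \<and> is_root f Ss j}" using i(2) by blast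
next
  fix x assume "x \<in> \<Union> {star j | j. j \<in> {1..m} \<and> is_root f Ss j}"
  then obtain j where j: "j \<in> {1..m}" "is_root f Ss j" "x \<in> star j" by blast
  then have "j \<in> nonnil" using root_iff by blast
  then show "x \<in> S - K" using j star_S[OF j(1,3)] unfolding K_eq by blast
qed

lemma ideal_K: "ideal S f K"
  unfolding ideal_def
proof (intro conjI ballI)
  show "K \<subseteq> S" unfolding K_eq by blast
  fix x s assume x: "x \<in> K" and s: "s \<in> S"
  have xS: "x \<in> S" using x unfolding K_eq by blast
  show "s \<cdot> x \<in> K" "x \<cdot> s \<in> K"
    using x star_prime(2)[OF _ s xS] star_prime(1)[OF _ xS s] closed[OF s xS] closed[OF xS s]
    unfolding K_eq by blast+
qed

text \<open>A recurrent set in K sinks into the block of a non-nilpotent factor. That block is part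
  of its own stem, which K avoids.\<close>

lemma nilpotent_K: "nilpotent K f"
proof -
  have KS: "K \<subseteq> S" unfolding K_eq by auto
  have fin: "finite K" using KS finite_S finite_subset by blast
  have cl: "x \<cdot> y \<in> K" if "x \<in> K" "y \<in> K" for x y using that ideal_K KS by (auto simp: ideal_def)
  have "\<not> (\<exists>B. B \<noteq> {} \<and> recurrent f K {} B)"
  proof
    assume "\<exists>B. B \<noteq> {} \<and> recurrent f K {} B"
    then obtain B where B: "B \<noteq> {}" "recurrent f K {} B" by blast
    obtain j B' where j: "j \<in> nonnil" and B': "B' \<noteq> {}" "recurrent f K (Ss (Suc j)) B'"
      and blk: "\<And>p q. (p, q) \<in> B' \<Longrightarrow> p \<in> blk Ss j \<and> q \<in> blk Ss j"
      by (rule recurrent_in_block[OF KS B(2,1)]) blast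
    obtain p q where pq: "(p, q) \<in> B'" using B'(1) by auto
    have "p \<in> K" using recurrentD(1)[OF B'(2) pq] .
    moreover have "p \<in> star j" using blk[OF pq] blk_star by blast
    ultimately show False using j unfolding K_eq by blast
  qed
  then show ?thesis using nilpotent_iff_no_recurrent[of K f, OF fin cl] by blast
qed

text \<open>If N meets a stem, multiplying by an element of its block gives a point of N in that
  block, and then N contains the whole block. The recurrent set of the factor, including its middle
  factors, then lives in N.\<close>

lemma nilpotent_ideal_sub_K:
  assumes id: "ideal S f N" and nil: "nilpotent N f" shows "N \<subseteq> K"
proof
  fix x assume x: "x \<in> N"
  have NS: "N \<subseteq> S" using id by (simp add: ideal_def)
  show "x \<in> K"
  proof (rule ccontr)
    assume "x \<notin> K"
    then obtain j where j: "j \<in> nonnil" "x \<in> star j" using x NS unfolding K_eq by blast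
    interpret nonnil_block S f "Ss j" "Ss (Suc j)" by (rule nonnil_block[OF j(1)])
    have xstem: "x \<in> stem" using j(2) star_eq_stem[OF j(1)] by simp
    obtain t where t: "t \<in> J" by (rule J_nonempty)
    have xt: "x \<cdot> t \<in> J" "x \<cdot> t \<in> N"
      using stemD(1)[OF xstem t] id x J_S[OF t] by (auto simp: ideal_def)
    have JN: "J \<subseteq> N"
    proof
      fix y assume "y \<in> J"
      then obtain c where c: "c \<in> L (x \<cdot> t)" "y \<in> R c" using same_ideal xt(1) by blast
      have "c \<in> N" using c(1) xt(2) id by (auto simp: Rs_def ideal_def)
      then show "y \<in> N" using c(2) id by (auto simp: Rs_def ideal_def)
    qed
    obtain B where B: "B \<noteq> {}" "recurrent f (Ss j) (Ss (Suc j)) B" using recurrent_pairs by blast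
    have "recurrent f N {} B" unfolding recurrent_def
    proof (intro conjI allI impI)
      show "sym B" using B(2) by (simp add: recurrent_def)
      fix p q assume pq: "(p, q) \<in> B"
      note D = recurrentD[OF B(2) pq]
      show "p \<in> N - {}" "q \<in> N - {}" "p \<noteq> q" using D JN by auto
      obtain w where w: "opt_in (Ss j) w" "(mul3 f p w q, mul3 f q w p) \<in> B" using D(7) by blast
      have "opt_in N w"
      proof (cases w)
        case (Some c)
        have c: "c \<in> Ss j" "c \<in> S" using w(1) A_S Some by (auto simp: opt_in_def)
        have S': "p \<in> S" "q \<in> S" using D(1,2) A_S by auto
        have "p \<cdot> c \<cdot> q \<notin> Ss (Suc j)" using recurrentD(3)[OF B(2) w(2)] Some by (simp add: mul3_def)
        then have "c \<notin> Ss (Suc j)" using Z_mult S' c by blast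
        then show ?thesis using c JN Some by (auto simp: opt_in_def)
      qed (simp add: opt_in_def)
      then show "\<exists>w. opt_in N w \<and> (mul3 f p w q, mul3 f q w p) \<in> B" using w(2) by blast
    qed
    moreover have "finite N" using NS finite_S finite_subset by blast
    moreover have "u \<cdot> v \<in> N" if "u \<in> N" "v \<in> N" for u v using that id NS by (auto simp: ideal_def)
    ultimately show False using nil nilpotent_iff_no_recurrent[of N f] B(1) by blast
  qed
qed

lemma K_isolated_vertices: "K = {x \<in> S. isolated_vertex S f x}"
proof (intro equalityI subsetI)
  fix x assume x: "x \<in> K"
  then have xS: "x \<in> S" unfolding K_eq by blast
  have "\<not> nn_edge f x y" if y: "y \<in> S" for y
  proof
    assume e: "nn_edge f x y"
    obtain j where "j \<in> nonnil" "x \<in> star j" "y \<in> star j" by (rule edge_imp_star[OF xS y e])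
    then show False using x unfolding K_eq by blast
  qed
  then show "x \<in> {x \<in> S. isolated_vertex S f x}" using xS by (simp add: isolated_vertex_def)
next
  fix x assume x: "x \<in> {x \<in> S. isolated_vertex S f x}"
  show "x \<in> K"
  proof (rule ccontr)
    assume "x \<notin> K"
    then obtain j where j: "j \<in> nonnil" "x \<in> star j" using x unfolding K_eq by blast
    obtain b where b: "b \<in> blk Ss j" "x \<noteq> b" "nn_edge f x b" by (rule star_neighbour[OF j])
    have "b \<in> S" using blk_S[OF nonnil_I[OF j(1)] b(1)] .
    then show False using x b by (auto simp: isolated_vertex_def)
  qed
qed

lemma blocks_mult_K_iff:
  assumes i: "i \<in> {1..m}" and j: "j \<in> {1..m}"
  shows "(\<forall>x\<in>blk Ss i. \<forall>y\<in>blk Ss j. x \<cdot> y \<in> K) \<longleftrightarrow>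
    \<not> (\<exists>k\<in>{1..m}. is_root f Ss k \<and> blk Ss i \<subseteq> star k \<and> blk Ss j \<subseteq> star k)"
proof (intro iffI notI ballI)
  assume all: "\<forall>x\<in>blk Ss i. \<forall>y\<in>blk Ss j. x \<cdot> y \<in> K"
  assume "\<exists>k\<in>{1..m}. is_root f Ss k \<and> blk Ss i \<subseteq> star k \<and> blk Ss j \<subseteq> star k"
  then obtain k where k: "k \<in> {1..m}" "is_root f Ss k" "blk Ss i \<subseteq> star k" "blk Ss j \<subseteq> star k" by blast
  have kn: "k \<in> nonnil" using root_iff k by blast
  obtain x y where xy: "x \<in> blk Ss i" "y \<in> blk Ss j" using blk_nonempty i j by blast
  have "x \<cdot> y \<in> star k" using xy k by (intro star_mult[OF kn]) auto
  then show False using all xy kn unfolding K_eq by blast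
next
  assume none: "\<not> (\<exists>k\<in>{1..m}. is_root f Ss k \<and> blk Ss i \<subseteq> star k \<and> blk Ss j \<subseteq> star k)"
  fix x y assume xy: "x \<in> blk Ss i" "y \<in> blk Ss j"
  have S': "x \<in> S" "y \<in> S" using xy blk_S i j by auto
  show "x \<cdot> y \<in> K"
  proof (rule ccontr)
    assume "x \<cdot> y \<notin> K"
    then have "x \<cdot> y \<in> S - K" using S' by simp
    then obtain k where k: "k \<in> {1..m}" "is_root f Ss k" "x \<cdot> y \<in> star k" unfolding K_complement by blast
    have kn: "k \<in> nonnil" using root_iff k by blast
    show False
      using none k(1,2) blk_sub_star[OF kn i xy(1) star_prime(1)[OF kn S' k(3)]]
        blk_sub_star[OF kn j xy(2) star_prime(2)[OF kn S' k(3)]] by blast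
  qed
qed

subsection \<open>Rees matrix coordinates\<close>

lemma rm_iso_mult:
  assumes "rm_iso f Ss i G I L P psi" "g \<in> carrier G" "e \<in> I" "l \<in> L" "h \<in> carrier G" "e' \<in> I" "l' \<in> L"
  shows "psi (g, e, l) \<cdot> psi (h, e', l') = psi (g \<otimes>\<^bsub>G\<^esub> P l e' \<otimes>\<^bsub>G\<^esub> h, e, l')"
    "g \<otimes>\<^bsub>G\<^esub> P l e' \<otimes>\<^bsub>G\<^esub> h \<in> carrier G"
proof -
  interpret group G using assms(1) by (simp add: rm_iso_def)
  have "psi (rm_mult G P (g, e, l) (h, e', l')) = psi (g, e, l) \<cdot> psi (h, e', l')"
    using assms unfolding rm_iso_def rm_carrier_def by blast
  then show "psi (g, e, l) \<cdot> psi (h, e', l') = psi (g \<otimes>\<^bsub>G\<^esub> P l e' \<otimes>\<^bsub>G\<^esub> h, e, l')"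
    by (simp add: rm_mult_def)
  have "P l e' \<in> carrier G" using assms by (simp add: rm_iso_def)
  then show "g \<otimes>\<^bsub>G\<^esub> P l e' \<otimes>\<^bsub>G\<^esub> h \<in> carrier G" using assms by simp
qed

lemma rm_iso_inj:
  assumes "rm_iso f Ss i G I L P psi" "g \<in> carrier G" "e \<in> I" "l \<in> L" "h \<in> carrier G" "e' \<in> I" "l' \<in> L"
    "psi (g, e, l) = psi (h, e', l')"
  shows "g = h" "e = e'" "l = l'"
proof -
  have "inj_on psi (rm_carrier G I L)" using assms(1) by (simp add: rm_iso_def bij_betw_def)
  moreover have "(g, e, l) \<in> rm_carrier G I L" "(h, e', l') \<in> rm_carrier G I L" using assms by (auto simp: rm_carrier_def)
  ultimately have "(g, e, l) = (h, e', l')" using assms(8) by (meson inj_onD)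
  then show "g = h" "e = e'" "l = l'" by auto
qed

lemma rm_iso_blk:
  assumes "rm_iso f Ss i G I L P psi"
  shows "g \<in> carrier G \<Longrightarrow> e \<in> I \<Longrightarrow> l \<in> L \<Longrightarrow> psi (g, e, l) \<in> blk Ss i"
    and "x \<in> blk Ss i \<Longrightarrow> \<exists>g\<in>carrier G. \<exists>e\<in>I. \<exists>l\<in>L. x = psi (g, e, l)"
proof -
  have im: "psi ` rm_carrier G I L = blk Ss i" using assms by (simp add: rm_iso_def bij_betw_def)
  show "g \<in> carrier G \<Longrightarrow> e \<in> I \<Longrightarrow> l \<in> L \<Longrightarrow> psi (g, e, l) \<in> blk Ss i"
    unfolding im[symmetric] rm_carrier_def by blast
  show "x \<in> blk Ss i \<Longrightarrow> \<exists>g\<in>carrier G. \<exists>e\<in>I. \<exists>l\<in>L. x = psi (g, e, l)"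
    unfolding im[symmetric] rm_carrier_def by blast
qed

lemma rm_iso_row:
  assumes i: "i \<in> nonnil" and iso: "rm_iso f Ss i G I L P psi"
    and g: "g \<in> carrier G" "e \<in> I" "l \<in> L" and h: "h \<in> carrier G" "e' \<in> I" "l' \<in> L"
    and R: "psi (g, e, l) \<in> Rs S f (psi (h, e', l'))"
  shows "e = e'"
proof -
  interpret nonnil_block S f "Ss i" "Ss (Suc i)" by (rule nonnil_block[OF i])
  define x y where "x = psi (g, e, l)" and "y = psi (h, e', l')"
  have J': "x \<in> J" "y \<in> J" using rm_iso_blk(1)[OF iso] g h by (auto simp: x_def y_def blk_def)
  note S' = J'[THEN J_S]
  have "x \<in> Rs S f y" using R by (simp add: x_def y_def)
  then consider "x = y" | s where "s \<in> S" "x = y \<cdot> s" by (auto simp: Rs_def)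
  then show ?thesis
  proof cases
    case 1 then show ?thesis using rm_iso_inj[OF iso g h] by (simp add: x_def y_def)
  next
    case 2
    \<comment> \<open>The factor s may have no coordinates; multiplying by x on the right replaces
      it by sx, which lies in the block. The row of a product is that of its left factor.\<close>
    have eq: "x \<cdot> x = y \<cdot> (s \<cdot> x)" using assoc[OF S'(2) 2(1) S'(1)] 2(2) by simp
    then have "y \<cdot> (s \<cdot> x) \<in> J" using J_mult[OF J'(1,1)] by simp
    then have "s \<cdot> x \<in> J" using J_right_factor A_mult(2)[of x s] J' S' 2(1) by blast
    then obtain k a b where k: "k \<in> carrier G" "a \<in> I" "b \<in> L" "s \<cdot> x = psi (k, a, b)"
      using rm_iso_blk(2)[OF iso, of "s \<cdot> x"] by (auto simp: blk_def)
    have "psi (g \<otimes>\<^bsub>G\<^esub> P l e \<otimes>\<^bsub>G\<^esub> g, e, l) = psi (h \<otimes>\<^bsub>G\<^esub> P l' a \<otimes>\<^bsub>G\<^esub> k, e', b)"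
      using eq rm_iso_mult(1)[OF iso g g] rm_iso_mult(1)[OF iso h k(1-3)] k(4) by (simp add: x_def y_def)
    then show ?thesis
      using rm_iso_inj(2)[OF iso rm_iso_mult(2)[OF iso g g] g(2,3) rm_iso_mult(2)[OF iso h k(1-3)] h(2) k(3)] by blast
  qed
qed

lemma rm_iso_column:
  assumes i: "i \<in> nonnil" and iso: "rm_iso f Ss i G I L P psi"
    and g: "g \<in> carrier G" "e \<in> I" "l \<in> L" and h: "h \<in> carrier G" "e' \<in> I" "l' \<in> L"
    and L: "psi (g, e, l) \<in> Ls S f (psi (h, e', l'))"
  shows "l = l'"
proof -
  interpret nonnil_block S f "Ss i" "Ss (Suc i)" by (rule nonnil_block[OF i])
  define x y where "x = psi (g, e, l)" and "y = psi (h, e', l')"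
  have J': "x \<in> J" "y \<in> J" using rm_iso_blk(1)[OF iso] g h by (auto simp: x_def y_def blk_def)
  note S' = J'[THEN J_S]
  have "x \<in> Ls S f y" using L by (simp add: x_def y_def)
  then consider "x = y" | s where "s \<in> S" "x = s \<cdot> y" by (auto simp: Rs_def)
  then show ?thesis
  proof cases
    case 1 then show ?thesis using rm_iso_inj[OF iso g h] by (simp add: x_def y_def)
  next
    case 2
    have eq: "x \<cdot> x = x \<cdot> s \<cdot> y" using assoc[OF S'(1) 2(1) S'(2)] 2(2) by simp
    then have "x \<cdot> s \<cdot> y \<in> J" using J_mult[OF J'(1,1)] by simp
    then have "x \<cdot> s \<in> J" using J_left_factor A_mult(1)[of x s] J' S' 2(1) by blast
    then obtain k a b where k: "k \<in> carrier G" "a \<in> I" "b \<in> L" "x \<cdot> s = psi (k, a, b)"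
      using rm_iso_blk(2)[OF iso, of "x \<cdot> s"] by (auto simp: blk_def)
    have "psi (g \<otimes>\<^bsub>G\<^esub> P l e \<otimes>\<^bsub>G\<^esub> g, e, l) = psi (k \<otimes>\<^bsub>G\<^esub> P b e' \<otimes>\<^bsub>G\<^esub> h, a, l')"
      using eq rm_iso_mult(1)[OF iso g g] rm_iso_mult(1)[OF iso k(1-3) h] k(4) by (simp add: x_def y_def)
    then show ?thesis
      using rm_iso_inj(3)[OF iso rm_iso_mult(2)[OF iso g g] g(2,3) rm_iso_mult(2)[OF iso k(1-3) h] k(2) h(3)] by blast
  qed
qed

definition indices :: "nat \<Rightarrow> 'g monoid \<Rightarrow> 'i set \<Rightarrow> 'l set \<Rightarrow> ('g \<times> 'i \<times> 'l \<Rightarrow> 'a) \<Rightarrow> 'a \<Rightarrow> 'i \<times> 'l \<Rightarrow> bool" where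
  "indices i G I L psi a el \<longleftrightarrow> fst el \<in> I \<and> snd el \<in> L \<and>
     f a ` blk Ss i \<subseteq> psi ` (carrier G \<times> {fst el} \<times> L) \<and>
     (\<lambda>x. f x a) ` blk Ss i \<subseteq> psi ` (carrier G \<times> I \<times> {snd el})"

lemma indices_exist:
  assumes i: "i \<in> nonnil" and iso: "rm_iso f Ss i G I L P psi" and a: "a \<in> star i"
  shows "\<exists>el. indices i G I L psi a el"
proof -
  interpret nonnil_block S f "Ss i" "Ss (Suc i)" by (rule nonnil_block[OF i])
  have a': "a \<in> stem" using a star_eq_stem[OF i] by simp
  obtain t where t: "t \<in> J" by (rule J_nonempty)
  obtain g e l0 where g: "g \<in> carrier G" "e \<in> I" "l0 \<in> L" "a \<cdot> t = psi (g, e, l0)"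
    using rm_iso_blk(2)[OF iso, of "a \<cdot> t"] stemD(1)[OF a' t] by (auto simp: blk_def)
  obtain h e0 l where h: "h \<in> carrier G" "e0 \<in> I" "l \<in> L" "t \<cdot> a = psi (h, e0, l)"
    using rm_iso_blk(2)[OF iso, of "t \<cdot> a"] stemD(2)[OF a' t] by (auto simp: blk_def)
  have "a \<cdot> x \<in> psi ` (carrier G \<times> {e} \<times> L)" if x: "x \<in> J" for x
  proof -
    obtain k e1 l1 where k: "k \<in> carrier G" "e1 \<in> I" "l1 \<in> L" "a \<cdot> x = psi (k, e1, l1)"
      using rm_iso_blk(2)[OF iso, of "a \<cdot> x"] stemD(1)[OF a' x] by (auto simp: blk_def)
    have "a \<cdot> x \<in> R (a \<cdot> t)" using stem_classes_constant(1)[OF a' t x] by simp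
    then have "e1 = e" using rm_iso_row[OF i iso k(1-3) g(1-3)] k(4) g(4) by simp
    then show ?thesis using k by blast
  qed
  moreover have "x \<cdot> a \<in> psi ` (carrier G \<times> I \<times> {l})" if x: "x \<in> J" for x
  proof -
    obtain k e1 l1 where k: "k \<in> carrier G" "e1 \<in> I" "l1 \<in> L" "x \<cdot> a = psi (k, e1, l1)"
      using rm_iso_blk(2)[OF iso, of "x \<cdot> a"] stemD(2)[OF a' x] by (auto simp: blk_def)
    have "x \<cdot> a \<in> Ls S f (t \<cdot> a)" using stem_classes_constant(2)[OF a' t x] by simp
    then have "l1 = l" using rm_iso_column[OF i iso k(1-3) h(1-3)] k(4) h(4) by simp
    then show ?thesis using k by blast
  qed
  ultimately have "indices i G I L psi a (e, l)" using g(2) h(3) by (auto simp: indices_def blk_def)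
  then show ?thesis by blast
qed

lemma indices_unique:
  assumes i: "i \<in> {1..m}" and iso: "rm_iso f Ss i G I L P psi"
    and el: "indices i G I L psi a el" and el': "indices i G I L psi a el'"
  shows "el = el'"
proof -
  obtain t where t: "t \<in> blk Ss i" using blk_nonempty[OF i] by auto
  obtain g l where g: "g \<in> carrier G" "l \<in> L" "a \<cdot> t = psi (g, fst el, l)"
    using el t unfolding indices_def by blast
  obtain g' l' where g': "g' \<in> carrier G" "l' \<in> L" "a \<cdot> t = psi (g', fst el', l')"
    using el' t unfolding indices_def by blast
  obtain h e where h: "h \<in> carrier G" "e \<in> I" "t \<cdot> a = psi (h, e, snd el)"
    using el t unfolding indices_def by blast
  obtain h' e' where h': "h' \<in> carrier G" "e' \<in> I" "t \<cdot> a = psi (h', e', snd el')"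
    using el' t unfolding indices_def by blast
  have I: "fst el \<in> I" "fst el' \<in> I" "snd el \<in> L" "snd el' \<in> L" using el el' by (auto simp: indices_def)
  have "fst el = fst el'" using rm_iso_inj(2)[OF iso g(1) I(1) g(2) g'(1) I(2) g'(2)] g(3) g'(3) by simp
  moreover have "snd el = snd el'" using rm_iso_inj(3)[OF iso h(1,2) I(3) h'(1,2) I(4)] h(3) h'(3) by simp
  ultimately show ?thesis by (rule prod_eqI)
qed

lemma Phi_eq_iff:
  assumes i: "i \<in> nonnil" and iso: "rm_iso f Ss i G I L P psi" and a: "a \<in> star i"
  shows "Phi S f Ss i G I L psi a = Some el \<longleftrightarrow> indices i G I L psi a el"
proof -
  have Phi: "Phi S f Ss i G I L psi a = Some (THE el. indices i G I L psi a el)"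
    using a by (simp add: Phi_def indices_def)
  obtain el0 where el0: "indices i G I L psi a el0" using indices_exist[OF i iso a] by blast
  have "(THE el. indices i G I L psi a el) = el0"
    by (rule the_equality) (rule el0, rule indices_unique[OF nonnil_I[OF i] iso _ el0])
  then have "Phi S f Ss i G I L psi a = Some el \<longleftrightarrow> el0 = el" using Phi by simp
  then show ?thesis using el0 indices_unique[OF nonnil_I[OF i] iso el0, of el] by blast
qed

text \<open>For t in the block, at already has row e. Multiplying by a block element on the right
  corrects the column and, by solving an equation in the group, the first coordinate; the other side
  is symmetric.\<close>

lemma indices_translate:
  assumes i: "i \<in> {1..m}" and iso: "rm_iso f Ss i G I L P psi" and a: "a \<in> S"
    and el: "indices i G I L psi a (e, l)" and g: "g \<in> carrier G"
  shows "\<exists>t\<in>blk Ss i. psi (g, e, l) = a \<cdot> t" "\<exists>t\<in>blk Ss i. psi (g, e, l) = t \<cdot> a"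
proof -
  interpret group G using iso by (simp add: rm_iso_def)
  have I: "e \<in> I" "l \<in> L" using el by (auto simp: indices_def)
  have P: "P y x \<in> carrier G" if "y \<in> L" "x \<in> I" for x y using that iso by (simp add: rm_iso_def)
  obtain t where t: "t \<in> blk Ss i" using blk_nonempty[OF i] by auto
  have tS: "t \<in> S" using blk_S[OF i t] .
  have mult_blk: "x \<cdot> y \<in> blk Ss i" if xy: "x \<in> blk Ss i" "y \<in> blk Ss i" for x y
  proof -
    obtain g1 e1 l1 where 1: "g1 \<in> carrier G" "e1 \<in> I" "l1 \<in> L" "x = psi (g1, e1, l1)"
      using rm_iso_blk(2)[OF iso xy(1)] by blast
    obtain g2 e2 l2 where 2: "g2 \<in> carrier G" "e2 \<in> I" "l2 \<in> L" "y = psi (g2, e2, l2)"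
      using rm_iso_blk(2)[OF iso xy(2)] by blast
    show ?thesis
      using rm_iso_mult[OF iso 1(1-3) 2(1-3)] rm_iso_blk(1)[OF iso _ 1(2) 2(3)] 1(4) 2(4) by simp
  qed
  have cancel: "x \<otimes>\<^bsub>G\<^esub> (inv\<^bsub>G\<^esub> x \<otimes>\<^bsub>G\<^esub> y) = y" "inv\<^bsub>G\<^esub> x \<otimes>\<^bsub>G\<^esub> (x \<otimes>\<^bsub>G\<^esub> y) = y" if "x \<in> carrier G" "y \<in> carrier G" for x y
    using that by (simp_all add: m_assoc[symmetric])
  have "a \<cdot> t \<in> psi ` (carrier G \<times> {e} \<times> L)" "t \<cdot> a \<in> psi ` (carrier G \<times> I \<times> {l})"
    using el t unfolding indices_def fst_conv snd_conv by blast+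
  then obtain g0 l0 k0 e0 where g0: "g0 \<in> carrier G" "l0 \<in> L" "a \<cdot> t = psi (g0, e, l0)"
    and k0: "k0 \<in> carrier G" "e0 \<in> I" "t \<cdot> a = psi (k0, e0, l)" by blast
  \<comment> \<open>The solution of g0 P(l0, e) h = g in the group.\<close>
  define h where "h = inv\<^bsub>G\<^esub> (P l0 e) \<otimes>\<^bsub>G\<^esub> (inv\<^bsub>G\<^esub> g0 \<otimes>\<^bsub>G\<^esub> g)"
  have h: "h \<in> carrier G" using P g0 g I by (simp add: h_def)
  have "g0 \<otimes>\<^bsub>G\<^esub> P l0 e \<otimes>\<^bsub>G\<^esub> h = g" using P[OF g0(2) I(1)] g0(1) g by (simp add: h_def m_assoc cancel)
  then have "a \<cdot> t \<cdot> psi (h, e, l) = psi (g, e, l)"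
    using rm_iso_mult(1)[OF iso g0(1) I(1) g0(2) h I] g0(3) by simp
  moreover have hb: "psi (h, e, l) \<in> blk Ss i" using rm_iso_blk(1)[OF iso h I] .
  ultimately show "\<exists>t\<in>blk Ss i. psi (g, e, l) = a \<cdot> t"
    using assoc[OF a tS blk_S[OF i hb]] mult_blk[OF t hb] by metis
  define k where "k = g \<otimes>\<^bsub>G\<^esub> inv\<^bsub>G\<^esub> k0 \<otimes>\<^bsub>G\<^esub> inv\<^bsub>G\<^esub> (P l e0)"
  have k: "k \<in> carrier G" using P k0 g I by (simp add: k_def)
  have "k \<otimes>\<^bsub>G\<^esub> P l e0 \<otimes>\<^bsub>G\<^esub> k0 = g" using P[OF I(2) k0(2)] k0(1) g by (simp add: k_def m_assoc cancel)
  then have "psi (k, e, l) \<cdot> (t \<cdot> a) = psi (g, e, l)"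
    using rm_iso_mult(1)[OF iso k I k0(1,2) I(2)] k0(3) by simp
  moreover have kb: "psi (k, e, l) \<in> blk Ss i" using rm_iso_blk(1)[OF iso k I] .
  ultimately show "\<exists>t\<in>blk Ss i. psi (g, e, l) = t \<cdot> a"
    using assoc[OF blk_S[OF i kb] tS a] mult_blk[OF kb t] by metis
qed

text \<open>Writing b for the matrix element, b = at = ua with t and u in the second block, hence in
  the third stem. They map the third block into itself, so all products of b with it are products of
  \<open>a\<close> with it, and the indices of \<open>a\<close> serve for b.\<close>

lemma Phi_compose:
  assumes i: "i1 \<in> {1..m}" "i2 \<in> nonnil" "i3 \<in> nonnil"
    and sub: "blk Ss i1 \<subseteq> star i2" "blk Ss i2 \<subseteq> star i3"
    and iso2: "rm_iso f Ss i2 G2 I2 L2 P2 psi2" and iso3: "rm_iso f Ss i3 G3 I3 L3 P3 psi3"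
    and a: "a \<in> blk Ss i1" and Phi2: "Phi S f Ss i2 G2 I2 L2 psi2 a = Some (e, l)" and g: "g \<in> carrier G2"
  shows "Phi S f Ss i3 G3 I3 L3 psi3 a = Phi S f Ss i3 G3 I3 L3 psi3 (psi2 (g, e, l))"
proof -
  interpret J3: nonnil_block S f "Ss i3" "Ss (Suc i3)" by (rule nonnil_block[OF i(3)])
  have m: "i2 \<in> {1..m}" "i3 \<in> {1..m}" using i nonnil_I by auto
  have aS: "a \<in> S" by (rule blk_S[OF i(1) a])
  have a2: "a \<in> star i2" using sub a by blast
  have a3: "a \<in> star i3" using star_transitive[OF i(1) m sub] a by blast
  have el: "indices i2 G2 I2 L2 psi2 a (e, l)" using Phi_eq_iff[OF i(2) iso2 a2] Phi2 by blast
  define b where "b = psi2 (g, e, l)"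
  obtain t where t: "t \<in> blk Ss i2" "b = a \<cdot> t" using indices_translate(1)[OF m(1) iso2 aS el g] b_def by blast
  obtain u where u: "u \<in> blk Ss i2" "b = u \<cdot> a" using indices_translate(2)[OF m(1) iso2 aS el g] b_def by blast
  have tS: "t \<in> S" "u \<in> S" using blk_S[OF m(1)] t u by auto
  have tu: "t \<in> J3.stem" "u \<in> J3.stem" using t u sub(2) star_eq_stem[OF i(3)] by auto
  have "b \<in> blk Ss i2" using rm_iso_blk(1)[OF iso2 g] el by (simp add: b_def indices_def)
  then have b3: "b \<in> star i3" using sub(2) by blast
  obtain el3 where el3: "indices i3 G3 I3 L3 psi3 a el3" using indices_exist[OF i(3) iso3 a3] by blast
  have rows: "f b ` blk Ss i3 \<subseteq> f a ` blk Ss i3"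
  proof
    fix y assume "y \<in> f b ` blk Ss i3"
    then obtain x where x: "x \<in> blk Ss i3" "y = b \<cdot> x" by blast
    have "y = a \<cdot> (t \<cdot> x)" using x t assoc[OF aS tS(1) blk_S[OF m(2) x(1)]] by simp
    moreover have "t \<cdot> x \<in> blk Ss i3" using J3.stemD(1)[OF tu(1)] x(1) by (simp add: blk_def)
    ultimately show "y \<in> f a ` blk Ss i3" by blast
  qed
  have columns: "(\<lambda>x. f x b) ` blk Ss i3 \<subseteq> (\<lambda>x. f x a) ` blk Ss i3"
  proof
    fix y assume "y \<in> (\<lambda>x. f x b) ` blk Ss i3"
    then obtain x where x: "x \<in> blk Ss i3" "y = x \<cdot> b" by blast
    have "y = x \<cdot> u \<cdot> a" using x u assoc[OF blk_S[OF m(2) x(1)] tS(2) aS] by simp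
    moreover have "x \<cdot> u \<in> blk Ss i3" using J3.stemD(2)[OF tu(2)] x(1) by (simp add: blk_def)
    ultimately show "y \<in> (\<lambda>x. f x a) ` blk Ss i3" by blast
  qed
  have "indices i3 G3 I3 L3 psi3 b el3"
    using el3 subset_trans[OF rows] subset_trans[OF columns] unfolding indices_def by simp
  then have "Phi S f Ss i3 G3 I3 L3 psi3 b = Some el3" using Phi_eq_iff[OF i(3) iso3 b3] by blast
  moreover have "Phi S f Ss i3 G3 I3 L3 psi3 a = Some el3" using Phi_eq_iff[OF i(3) iso3 a3] el3 by blast
  ultimately show ?thesis unfolding b_def by simp
qed

end

theorem theorem3p7:
  fixes S :: "'a set" and f :: "'a \<Rightarrow> 'a \<Rightarrow> 'a" and Ss :: "nat \<Rightarrow> 'a set" and m :: nat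
  assumes sg: "sgrp S f" and ne: "S \<noteq> {}" and fin: "finite S"
    and pn: "pseudo_nilpotent S f"
    and ps: "principal_series S f Ss m"
  shows
    \<comment> \<open>(1)\<close>
    "(ideal S f (Kset S f Ss m) \<and> nilpotent (Kset S f Ss m) f \<and>
       (\<forall>J. ideal S f J \<and> nilpotent J f \<longrightarrow> J \<subseteq> Kset S f Ss m) \<and>
       Kset S f Ss m = {x \<in> S. isolated_vertex S f x})
   \<and> \<comment> \<open>(2)\<close>
    (\<forall>i1\<in>{1..m}. \<forall>i2\<in>{1..m}. \<forall>i3\<in>{1..m}.
       blk Ss i1 \<subseteq> Sstar S f Ss i2 \<and> blk Ss i2 \<subseteq> Sstar S f Ss i3 \<longrightarrow>
         blk Ss i1 \<subseteq> Sstar S f Ss i3 \<and>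
         (\<forall>(G2 :: 'g2 monoid) (I2 :: 'i2 set) (L2 :: 'l2 set) P2 psi2
            (G3 :: 'g3 monoid) (I3 :: 'i3 set) (L3 :: 'l3 set) P3 psi3.
            \<not> factor_nilp f Ss i2 \<and> \<not> factor_nilp f Ss i3 \<and>
            rm_iso f Ss i2 G2 I2 L2 P2 psi2 \<and> rm_iso f Ss i3 G3 I3 L3 P3 psi3 \<longrightarrow>
            (\<forall>a\<in>blk Ss i1. \<forall>e l. Phi S f Ss i2 G2 I2 L2 psi2 a = Some (e, l) \<longrightarrow>
               (\<forall>g\<in>carrier G2. Phi S f Ss i3 G3 I3 L3 psi3 a =
                                 Phi S f Ss i3 G3 I3 L3 psi3 (psi2 (g, e, l))))))
   \<and> \<comment> \<open>(3)\<close>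
    (\<forall>i\<in>{1..m}. \<not> is_isolated S f Ss m i \<and> \<not> is_root f Ss i \<longrightarrow>
       (\<exists>j\<in>{1..m}. is_root f Ss j \<and> i < j \<and> blk Ss i \<subseteq> Sstar S f Ss j))
   \<and> \<comment> \<open>(4)\<close>
    S - Kset S f Ss m = \<Union> {Sstar S f Ss j | j. j \<in> {1..m} \<and> is_root f Ss j}
   \<and> \<comment> \<open>(5)\<close>
    (\<forall>i\<in>{1..m}. is_root f Ss i \<longrightarrow>
       (\<forall>x\<in>Sstar S f Ss i. \<forall>y\<in>Sstar S f Ss i. f x y \<in> Sstar S f Ss i))
   \<and> \<comment> \<open>(6)\<close>
    (\<forall>i\<in>{1..m}. \<forall>j\<in>{1..m}.
       (\<forall>x\<in>blk Ss i. \<forall>y\<in>blk Ss j. f x y \<in> Kset S f Ss m) \<longleftrightarrow>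
       \<not> (\<exists>k\<in>{1..m}. is_root f Ss k \<and> blk Ss i \<subseteq> Sstar S f Ss k \<and> blk Ss j \<subseteq> Sstar S f Ss k))"
proof -
  interpret pn_series S f Ss m
    using sg fin pseudo_nilpotent_pairs_inherit[OF sg fin pn] ps by unfold_locales
  have part3: "\<exists>j\<in>{1..m}. is_root f Ss j \<and> i < j \<and> blk Ss i \<subseteq> Sstar S f Ss j"
    if i: "i \<in> {1..m}" and niso: "\<not> is_isolated S f Ss m i" and nroot: "\<not> is_root f Ss i" for i
  proof -
    obtain j where j: "j \<in> nonnil" "blk Ss i \<subseteq> star j" using isolated_iff[OF i] niso by blast
    obtain k where k: "k \<in> {1..m}" "is_root f Ss k" "j \<le> k" "blk Ss i \<subseteq> star k"
      by (rule star_in_root_star[OF i j])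
    have "i \<le> k" "i \<noteq> k" using blk_star_le[OF k(1) i k(4)] k(2) nroot by auto
    then show ?thesis using k by auto
  qed
  have root_nonnil: "i \<in> nonnil" if "i \<in> {1..m}" "is_root f Ss i" for i
    using root_iff[OF that(1)] that(2) by blast
  have part2: "Phi S f Ss i3 G3 I3 L3 psi3 a = Phi S f Ss i3 G3 I3 L3 psi3 (psi2 (g, e, l))"
    if "i1 \<in> {1..m}" "i2 \<in> {1..m}" "i3 \<in> {1..m}" "blk Ss i1 \<subseteq> star i2" "blk Ss i2 \<subseteq> star i3"
      "\<not> factor_nilp f Ss i2" "\<not> factor_nilp f Ss i3"
      "rm_iso f Ss i2 G2 I2 L2 P2 psi2" "rm_iso f Ss i3 G3 I3 L3 P3 psi3"
      "a \<in> blk Ss i1" "Phi S f Ss i2 G2 I2 L2 psi2 a = Some (e, l)" "g \<in> carrier G2"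
    for i1 i2 i3 a e l g and G2 :: "'g2 monoid" and I2 :: "'i2 set" and L2 :: "'l2 set" and P2 psi2
      and G3 :: "'g3 monoid" and I3 :: "'i3 set" and L3 :: "'l3 set" and P3 psi3
    using that by (intro Phi_compose[of i1 i2 i3]) (auto simp: nonnil_def)
  show ?thesis
    apply (intro conjI ballI allI impI)
    subgoal by (rule ideal_K)
    subgoal by (rule nilpotent_K)
    subgoal by (elim conjE) (rule nilpotent_ideal_sub_K)
    subgoal by (rule K_isolated_vertices)
    subgoal by (elim conjE) (rule star_transitive)
    subgoal by (elim conjE) (rule part2)
    subgoal by (elim conjE) (rule part3)
    subgoal by (rule K_complement)
    subgoal by (rule star_mult[OF root_nonnil])
    subgoal by (rule blocks_mult_K_iff)
    done
qed

end
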